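(* For each of the four permeability parameterizations (geometry given by the Layer Model with Fault or by the Channelized Model; permeability values $\kappa_i$ either piecewise constant or continuous), the observation map $\mathcal{G}=L\circ G\circ F: U\to Y=\mathbb{R}^J$ is continuous, where $U\subset\mathcal{B}$ carries the topology induced by the norm of the Banach space $\mathcal{B}$.
   Context: Let $D=(0,1)^2$ with points $(x,y)$, $V=H^1_0(D)$ with norm $\|p\|_V=\|\nabla p\|_{L^2(D)}$, $V^*$ its dual, and $X=\{g\in L^\infty(D;\mathbb{R}) : \operatorname{ess\,inf}_D g>0\}$. Fix $f\in V^*$. For $\kappa\in X$ let $G(\kappa)=p\in V$ be the unique weak solution of $-\nabla\cdot(\kappa\nabla p)=f$ in $D$, $p=0$ on $\partial D$. Let $L:V\to\mathbb{R}^J$, $L(p)=(l_1(p),\dots,l_J(p))^T$ with fixed $l_j\in V^*$. The unknown is $u=(u_g,u_\kappa)\in U=U_g\times U_\kappa$, and $F(u)=\kappa=\sum_{i=1}^n\kappa_i\chi_{D_i}$, where the open sets $D_i\subset D$ are determined by the geometric parameter $u_g$ and are pairwise disjoint with $\bigcup_i\overline{D_i}=\overline{D}$. Geometries. (1) Layer Model with Fault ($n\ge 2$ layers): $u_g=(a,b,c)\in U_g=A^2\times[-c^\star,c^\star]$ with $c^\star>0$ and $A=\{\mathbf{x}\in\mathbb{R}^{n-1}:\sum_{i=1}^{n-1}x_i\le1,\ x_i\ge0\}$. Here $a_i$ and $b_i$ are the thicknesses of layer $i$ at the right side $x=1$ and the left side $x=0$ of $D$, with layers numbered from top to bottom. For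 $1\le i\le n-1$ put $h_i(x)=\sum_{k=1}^i\big(b_k(1-x)+a_kx\big)$, and let the depth (distance below the top of $D$) of the interface between layers $i$ and $i+1$ be $S_i(x)=h_i(x)+c$ for $x<\frac12$ and $S_i(x)=h_i(x)$ for $x>\frac12$ (a vertical fault at $x=\frac12$ with slip $c$: the left part slips down if $c>0$, up if $c<0$). With $S_0=-\infty$, $S_n=+\infty$, $D_i=\{(x,y)\in D: x\ne\frac12,\ S_{i-1}(x)<1-y<S_i(x)\}$. (2) Channelized Model ($n=2$): $u_g=(d_1,\dots,d_5)\in U_g=\prod_{i=1}^5[d_i^-,d_i^+]$, with $[d_3^-,d_3^+]\subset(-\pi/2,\pi/2)$ and $d_5^-\ge0$. $D_1=\{(x,y)\in D: g(x)<y<g(x)+d_5\}$ is the channel interior, where $g(x)=d_1\sin(d_2x)+\tan(d_3)x+d_4$, and $D_2=D\setminus\overline{D_1}$ is the exterior. Permeability values. Piecewise constant: $u_\kappa=(\kappa_1,\dots,\kappa_n)\in U_\kappa=(0,\infty)^n$. Continuous: $u_\kappa=(\log\kappa_1,\dots,\log\kappa_n)\in U_\kappa=C(\overline{D};\mathbb{R}^n)$. The separable Banach space $\mathcal{B}\supset U$ is $\mathbb{R}^{m}\times\mathbb{R}^n$ in the constant case and $\mathbb{R}^{m}\times C(\overline{D};\mathbb{R}^n)$ (sup norm on the second factor) in the continuous case, with $m=2n-1$ for the layer model and $m=5$ for the channelized model. *)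

theory Defs
  imports "HOL-Analysis.Analysis" "HOL-Probability.Essential_Supremum"
begin

section \<open>Sobolev spaces on the unit square\<close>

definition D :: "(real \<times> real) set" where
  "D = {0<..<1} \<times> {0<..<1}"

text \<open>
  Elements of Lebesgue and Sobolev spaces are represented by functions on the whole plane;
  only the values on \<open>D\<close>, up to null sets, are relevant. No quotient is taken: two functions
  represent the same element iff they agree almost everywhere on \<open>D\<close>.
\<close>

definition L2 :: "(real \<times> real \<Rightarrow> 'b::euclidean_space) set" where
  "L2 = {g \<in> borel_measurable (lebesgue_on D). integrable (lebesgue_on D) (\<lambda>z. (norm (g z))\<^sup>2)}"

primrec Ck :: "nat \<Rightarrow> (real \<times> real \<Rightarrow> real) \<Rightarrow> bool" where
  "Ck 0 \<phi> \<longleftrightarrow> continuous_on UNIV \<phi>"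
| "Ck (Suc k) \<phi> \<longleftrightarrow> (\<forall>z. \<phi> differentiable (at z)) \<and>
     (\<forall>i\<in>Basis. Ck k (\<lambda>z. frechet_derivative \<phi> (at z) i))"

definition test_functions :: "(real \<times> real \<Rightarrow> real) set" where
  "test_functions = {\<phi>. (\<forall>k. Ck k \<phi>) \<and>
     compact (closure {z. \<phi> z \<noteq> 0}) \<and> closure {z. \<phi> z \<noteq> 0} \<subseteq> D}"

definition has_weak_gradient ::
    "(real \<times> real \<Rightarrow> real) \<Rightarrow> (real \<times> real \<Rightarrow> real \<times> real) \<Rightarrow> bool" where
  "has_weak_gradient p g \<longleftrightarrow> (\<forall>\<phi>\<in>test_functions. \<forall>i\<in>Basis.
     (LINT z|lebesgue_on D. p z * frechet_derivative \<phi> (at z) i) =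
     - (LINT z|lebesgue_on D. (g z \<bullet> i) * \<phi> z))"

definition H1 :: "(real \<times> real \<Rightarrow> real) set" where
  "H1 = {p \<in> L2. \<exists>g\<in>L2. has_weak_gradient p g}"

text \<open>The weak gradient is determined only up to null sets; some representative is chosen.\<close>

definition wgrad :: "(real \<times> real \<Rightarrow> real) \<Rightarrow> real \<times> real \<Rightarrow> real \<times> real" where
  "wgrad p = (SOME g. g \<in> L2 \<and> has_weak_gradient p g)"

definition H1_norm :: "(real \<times> real \<Rightarrow> real) \<Rightarrow> real" where
  "H1_norm p = sqrt ((LINT z|lebesgue_on D. (p z)\<^sup>2) + (LINT z|lebesgue_on D. (norm (wgrad p z))\<^sup>2))"

text \<open>\<open>V\<close> is \<open>H\<^sup>1\<^sub>0(D)\<close>, the closure of the test functions in \<open>H\<^sup>1(D)\<close>.\<close>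

definition V :: "(real \<times> real \<Rightarrow> real) set" where
  "V = {p \<in> H1. \<exists>\<phi>. (\<forall>k. \<phi> k \<in> test_functions) \<and> (\<lambda>k::nat. H1_norm (\<lambda>z. p z - \<phi> k z)) \<longlonglongrightarrow> 0}"

definition V_norm :: "(real \<times> real \<Rightarrow> real) \<Rightarrow> real" where
  "V_norm p = sqrt (LINT z|lebesgue_on D. (norm (wgrad p z))\<^sup>2)"

text \<open>
  Boundedness forces an element of the dual to take the same value on any two functions
  in \<open>V\<close> that agree almost everywhere on \<open>D\<close>. Its values outside \<open>V\<close> are irrelevant.
\<close>

definition V_dual :: "((real \<times> real \<Rightarrow> real) \<Rightarrow> real) set" where
  "V_dual = {l. (\<forall>p\<in>V. \<forall>q\<in>V. \<forall>s t. l (\<lambda>z. s * p z + t * q z) = s * l p + t * l q) \<and>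
     (\<exists>C. \<forall>p\<in>V. \<bar>l p\<bar> \<le> C * V_norm p)}"


section \<open>The forward and observation operators\<close>

definition Linfty :: "(real \<times> real \<Rightarrow> real) set" where
  "Linfty = {g \<in> borel_measurable (lebesgue_on D). esssup (lebesgue_on D) (\<lambda>z. ereal \<bar>g z\<bar>) < \<infinity>}"

definition essinf :: "(real \<times> real \<Rightarrow> real) \<Rightarrow> ereal" where
  "essinf g = - esssup (lebesgue_on D) (\<lambda>z. - ereal (g z))"

definition X :: "(real \<times> real \<Rightarrow> real) set" where
  "X = {g \<in> Linfty. essinf g > 0}"

definition weak_solution ::
    "((real \<times> real \<Rightarrow> real) \<Rightarrow> real) \<Rightarrow> (real \<times> real \<Rightarrow> real) \<Rightarrow> (real \<times> real \<Rightarrow> real) \<Rightarrow> bool" where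
  "weak_solution f \<kappa> p \<longleftrightarrow> \<kappa> \<in> X \<and> p \<in> V \<and>
     (\<forall>v\<in>V. (LINT z|lebesgue_on D. \<kappa> z * (wgrad p z \<bullet> wgrad v z)) = f v)"

text \<open>The weak solution is unique as an element of \<open>V\<close>, that is, up to null sets.\<close>

definition G ::
    "((real \<times> real \<Rightarrow> real) \<Rightarrow> real) \<Rightarrow> (real \<times> real \<Rightarrow> real) \<Rightarrow> real \<times> real \<Rightarrow> real" where
  "G f \<kappa> = (SOME p. weak_solution f \<kappa> p)"

definition L ::
    "('j::finite \<Rightarrow> (real \<times> real \<Rightarrow> real) \<Rightarrow> real) \<Rightarrow> (real \<times> real \<Rightarrow> real) \<Rightarrow> real ^ 'j" where
  "L l p = (\<chi> j. l j p)"


section \<open>Continuous functions on the closed square\<close>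

text \<open>
  With the closed square as a type, \<open>closed_square \<Rightarrow>\<^sub>C (real ^ 'n)\<close> is the Banach space of all
  \<open>real ^ 'n\<close>-valued continuous functions on \<open>closure D\<close> with the sup norm (boundedness being
  automatic by compactness).
\<close>

typedef closed_square = "closure D"
  morphisms square_point Square_Point
proof -
  have "(1/2, 1/2) \<in> closure D"
    by (rule subsetD[OF closure_subset]) (simp add: D_def)
  then show "\<exists>z. z \<in> closure D" ..
qed

instantiation closed_square :: topological_space
begin

definition open_closed_square :: "closed_square set \<Rightarrow> bool" where
  "open_closed_square W \<longleftrightarrow> (\<exists>T. open T \<and> W = square_point -` T)"

instance
proof
  show "open (UNIV :: closed_square set)"
    unfolding open_closed_square_def by (rule exI[of _ UNIV]) simp
next
  fix S T :: "closed_square set"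
  assume "open S" "open T"
  then show "open (S \<inter> T)"
    unfolding open_closed_square_def by (metis open_Int vimage_Int)
next
  fix K :: "closed_square set set"
  assume "\<forall>S\<in>K. open S"
  then obtain t where t: "\<And>S. S \<in> K \<Longrightarrow> open (t S) \<and> S = square_point -` t S"
    unfolding open_closed_square_def by metis
  then have "\<Union>K = square_point -` (\<Union>S\<in>K. t S)"
    by auto
  moreover have "open (\<Union>S\<in>K. t S)"
    using t by auto
  ultimately show "open (\<Union>K)"
    unfolding open_closed_square_def by blast
qed

end


section \<open>Permeability\<close>

text \<open>\<open>\<Omega> i\<close> is the region and \<open>k i\<close> the value of the permeability on it, for \<open>1 \<le> i \<le> n\<close>.\<close>

definition permeability ::
    "nat \<Rightarrow> (nat \<Rightarrow> (real \<times> real) set) \<Rightarrow> (nat \<Rightarrow> real \<times> real \<Rightarrow> real) \<Rightarrow> real \<times> real \<Rightarrow> real" where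
  "permeability n \<Omega> k z = (\<Sum>i=1..n. k i z * indicator (\<Omega> i) z)"

text \<open>
  Vectors indexed by \<open>1, \<dots>, n\<close> are elements of \<open>real ^ 'n\<close> together with an enumeration
  \<open>\<nu>\<close>, a bijection from \<open>{1..n}\<close> to \<open>'n\<close>: component \<open>i\<close> of \<open>v\<close> is \<open>v $ \<nu> i\<close>.
  In the continuous case the components are the logarithms of the permeabilities.
\<close>

definition const_values :: "(nat \<Rightarrow> 'n) \<Rightarrow> (real ^ 'n) \<Rightarrow> nat \<Rightarrow> real \<times> real \<Rightarrow> real" where
  "const_values \<nu> v i z = v $ \<nu> i"

definition cont_values ::
    "(nat \<Rightarrow> 'n::finite) \<Rightarrow> (closed_square \<Rightarrow>\<^sub>C (real ^ 'n)) \<Rightarrow> nat \<Rightarrow> real \<times> real \<Rightarrow> real" where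
  "cont_values \<nu> v i z = exp (apply_bcontfun v (Square_Point z) $ \<nu> i)"

definition U_const :: "(real ^ 'n) set" where
  "U_const = {v. \<forall>i. 0 < v $ i}"


section \<open>Layer model with fault\<close>

text \<open>Here \<open>'m\<close> has \<open>n - 1\<close> elements, enumerated by \<open>\<mu>\<close>.\<close>

definition A :: "(real ^ 'm::finite) set" where
  "A = {x. (\<Sum>i\<in>UNIV. x $ i) \<le> 1 \<and> (\<forall>i. 0 \<le> x $ i)}"

definition U_layer :: "real \<Rightarrow> ((real ^ 'm) \<times> (real ^ 'm) \<times> real) set" where
  "U_layer cstar = A \<times> A \<times> {- cstar..cstar}"

definition layer_h :: "(nat \<Rightarrow> 'm) \<Rightarrow> (real ^ 'm) \<Rightarrow> (real ^ 'm) \<Rightarrow> nat \<Rightarrow> real \<Rightarrow> real" where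
  "layer_h \<mu> a b i x = (\<Sum>k=1..i. b $ \<mu> k * (1 - x) + a $ \<mu> k * x)"

definition layer_S ::
    "nat \<Rightarrow> (nat \<Rightarrow> 'm) \<Rightarrow> (real ^ 'm) \<times> (real ^ 'm) \<times> real \<Rightarrow> nat \<Rightarrow> real \<Rightarrow> ereal" where
  "layer_S n \<mu> = (\<lambda>(a, b, c) i x.
     if i = 0 then -\<infinity> else if i = n then \<infinity>
     else ereal (layer_h \<mu> a b i x + (if x < 1/2 then c else 0)))"

definition layer_region ::
    "nat \<Rightarrow> (nat \<Rightarrow> 'm) \<Rightarrow> (real ^ 'm) \<times> (real ^ 'm) \<times> real \<Rightarrow> nat \<Rightarrow> (real \<times> real) set" where
  "layer_region n \<mu> w i = {(x, y). (x, y) \<in> D \<and> x \<noteq> 1/2 \<and>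
     layer_S n \<mu> w (i - 1) x < ereal (1 - y) \<and> ereal (1 - y) < layer_S n \<mu> w i x}"

definition F_layer_const ::
    "nat \<Rightarrow> (nat \<Rightarrow> 'm) \<Rightarrow> (nat \<Rightarrow> 'n) \<Rightarrow>
     ((real ^ 'm) \<times> (real ^ 'm) \<times> real) \<times> (real ^ 'n) \<Rightarrow> real \<times> real \<Rightarrow> real" where
  "F_layer_const n \<mu> \<nu> = (\<lambda>(w, v). permeability n (layer_region n \<mu> w) (const_values \<nu> v))"

definition F_layer_cont ::
    "nat \<Rightarrow> (nat \<Rightarrow> 'm) \<Rightarrow> (nat \<Rightarrow> 'n::finite) \<Rightarrow>
     ((real ^ 'm) \<times> (real ^ 'm) \<times> real) \<times> (closed_square \<Rightarrow>\<^sub>C (real ^ 'n)) \<Rightarrow> real \<times> real \<Rightarrow> real" where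
  "F_layer_cont n \<mu> \<nu> = (\<lambda>(w, v). permeability n (layer_region n \<mu> w) (cont_values \<nu> v))"


section \<open>Channelized model\<close>

definition U_channel :: "(real ^ 5) \<Rightarrow> (real ^ 5) \<Rightarrow> (real ^ 5) set" where
  "U_channel dm dp = {d. \<forall>i. dm $ i \<le> d $ i \<and> d $ i \<le> dp $ i}"

definition channel_g :: "(real ^ 5) \<Rightarrow> real \<Rightarrow> real" where
  "channel_g d x = d $ 1 * sin (d $ 2 * x) + tan (d $ 3) * x + d $ 4"

definition channel_interior :: "(real ^ 5) \<Rightarrow> (real \<times> real) set" where
  "channel_interior d = {(x, y). (x, y) \<in> D \<and> channel_g d x < y \<and> y < channel_g d x + d $ 5}"

definition channel_region :: "(real ^ 5) \<Rightarrow> nat \<Rightarrow> (real \<times> real) set" where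
  "channel_region d i = (if i = 1 then channel_interior d else D - closure (channel_interior d))"

text \<open>The two components are enumerated by \<open>of_nat :: nat \<Rightarrow> 2\<close>, which maps 1 and 2 to 1 and 2.\<close>

definition F_channel_const :: "(real ^ 5) \<times> (real ^ 2) \<Rightarrow> real \<times> real \<Rightarrow> real" where
  "F_channel_const = (\<lambda>(d, v). permeability 2 (channel_region d) (const_values of_nat v))"

definition F_channel_cont ::
    "(real ^ 5) \<times> (closed_square \<Rightarrow>\<^sub>C (real ^ 2)) \<Rightarrow> real \<times> real \<Rightarrow> real" where
  "F_channel_cont = (\<lambda>(d, v). permeability 2 (channel_region d) (cont_values of_nat v))"

end

theory Submission
  imports Defs
begin

text \<open>
  Let \<open>p = G f \<kappa>\<close> and \<open>q = G f \<kappa>'\<close>, with \<open>lo\<close> a positive lower bound of \<open>\<kappa>'\<close>. Subtracting the two weak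
  formulations and testing with \<open>q - p\<close> gives \<open>lo * V_norm (q - p) \<le> \<parallel>(\<kappa> - \<kappa>') \<nabla>p\<parallel>\<close> in \<open>L\<^sup>2\<close>
  (\<open>weak_solution_stability\<close>). The fixed function \<open>\<nabla>p\<close> absorbs the coefficient difference, so the right-hand
  side tends to zero as soon as the coefficients converge almost everywhere within fixed bounds
  \<open>0 < lo \<le> hi\<close> (\<open>observation_tendsto\<close>). Uniform convergence would be too much to ask: where an interface
  moves, the permeability jumps by a fixed amount. Convergence almost everywhere does hold: a point
  that lies on no interface of the limiting geometry keeps its layer number, or its side of the
  channel, under small changes of the geometric parameter, and the interfaces are null sets because they are
  graphs and a vertical line (\<open>layer_region_stable\<close>, \<open>channel_region_stable\<close>). On a fixed region the
  values depend continuously on their parameter and are locally bounded away from zero and infinity.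
  These facts are combined in \<open>observation_map_continuous\<close>, for any geometry and any kind of values
  with these properties.

  The stability estimate concerns chosen weak solutions, so their existence is needed first. It follows from the Riesz
  representation of \<open>f\<close> with respect to the energy form, for which \<open>V\<close> has to be complete
  (\<open>V_complete\<close>). Completeness rests on that of \<open>L\<^sup>2\<close>, on the closedness of the weak
  gradient, and on the Poincare inequality, which makes a sequence that is Cauchy in \<open>V_norm\<close> also
  Cauchy in \<open>L\<^sup>2\<close>. Because \<open>wgrad\<close> is an arbitrary choice among weak gradients, even its linearity (almost
  everywhere) needs their uniqueness, that is, the fundamental lemma of the calculus of
  variations; this is where smooth bump functions enter.
\<close>

section \<open>Semi-inner products on spaces of functions\<close>

lemma quadratic_nonneg_imp_discriminant:
  fixes a b c :: real
  assumes "\<And>t. 0 \<le> a + 2 * t * b + t\<^sup>2 * c" "0 \<le> c"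
  shows "b\<^sup>2 \<le> a * c"
proof (cases "c = 0")
  case True
  have "b = 0"
  proof (rule ccontr)
    assume "b \<noteq> 0"
    with assms(1)[of "- (a + 1) / (2 * b)"] True show False by (simp add: field_simps)
  qed
  then show ?thesis using True by simp
next
  case False
  then have "c > 0" using assms(2) by simp
  with assms(1)[of "- b / c"] show ?thesis
    by (simp add: field_simps power2_eq_square)
qed

text \<open>
  Functions that agree almost everywhere are not identified here, so every form below is only
  positive semidefinite.
\<close>

locale semi_inner_space =
  fixes S :: "('a \<Rightarrow> 'b::real_vector) set" and B :: "('a \<Rightarrow> 'b) \<Rightarrow> ('a \<Rightarrow> 'b) \<Rightarrow> real"
  assumes lin_closed: "p \<in> S \<Longrightarrow> q \<in> S \<Longrightarrow> (\<lambda>z. s *\<^sub>R p z + t *\<^sub>R q z) \<in> S"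
    and sym: "p \<in> S \<Longrightarrow> q \<in> S \<Longrightarrow> B p q = B q p"
    and lin: "p \<in> S \<Longrightarrow> q \<in> S \<Longrightarrow> r \<in> S \<Longrightarrow>
      B (\<lambda>z. s *\<^sub>R p z + t *\<^sub>R q z) r = s * B p r + t * B q r"
    and nonneg: "p \<in> S \<Longrightarrow> 0 \<le> B p p"
begin

lemma lin_right:
  assumes "p \<in> S" "q \<in> S" "r \<in> S"
  shows "B r (\<lambda>z. s *\<^sub>R p z + t *\<^sub>R q z) = s * B r p + t * B r q"
  using assms by (simp only: sym[of r] lin_closed lin)

lemma quadratic:
  assumes "p \<in> S" "q \<in> S"
  shows "B (\<lambda>z. s *\<^sub>R p z + t *\<^sub>R q z) (\<lambda>z. s *\<^sub>R p z + t *\<^sub>R q z)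
    = s\<^sup>2 * B p p + 2 * s * t * B p q + t\<^sup>2 * B q q"
  using assms by (simp add: lin lin_right lin_closed sym[of q p] power2_eq_square algebra_simps)

lemma diff_closed: "p \<in> S \<Longrightarrow> q \<in> S \<Longrightarrow> (\<lambda>z. p z - q z) \<in> S"
  using lin_closed[of p q 1 "-1"] by simp

lemma diff_left: "p \<in> S \<Longrightarrow> q \<in> S \<Longrightarrow> r \<in> S \<Longrightarrow> B (\<lambda>z. p z - q z) r = B p r - B q r"
  using lin[of p q r 1 "-1"] by simp

lemma Cauchy_Schwarz:
  assumes "p \<in> S" "q \<in> S"
  shows "(B p q)\<^sup>2 \<le> B p p * B q q"
proof (rule quadratic_nonneg_imp_discriminant)
  fix t :: real
  show "0 \<le> B p p + 2 * t * B p q + t\<^sup>2 * B q q"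
    using nonneg[OF lin_closed[OF assms, of 1 t]] unfolding quadratic[OF assms] by simp
qed (rule nonneg[OF assms(2)])

lemma Cauchy_Schwarz_sqrt:
  assumes "p \<in> S" "q \<in> S"
  shows "\<bar>B p q\<bar> \<le> sqrt (B p p) * sqrt (B q q)"
  using real_sqrt_le_mono[OF Cauchy_Schwarz[OF assms]] by (simp add: real_sqrt_mult)

lemma square_lin_le:
  assumes "p \<in> S" "q \<in> S"
  shows "B (\<lambda>z. s *\<^sub>R p z + t *\<^sub>R q z) (\<lambda>z. s *\<^sub>R p z + t *\<^sub>R q z)
    \<le> 2 * s\<^sup>2 * B p p + 2 * t\<^sup>2 * B q q"
  using quadratic[OF assms, of s t] quadratic[OF assms, of s "-t"]
    nonneg[OF lin_closed[OF assms, of s "-t"]] by (simp add: algebra_simps)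

lemma square_add_le:
  assumes "p \<in> S" "q \<in> S"
  shows "B (\<lambda>z. p z + q z) (\<lambda>z. p z + q z) \<le> 2 * B p p + 2 * B q q"
  using square_lin_le[OF assms, of 1 1] by simp

lemma square_diff_commute:
  assumes "p \<in> S" "q \<in> S"
  shows "B (\<lambda>z. q z - p z) (\<lambda>z. q z - p z) = B (\<lambda>z. p z - q z) (\<lambda>z. p z - q z)"
  using quadratic[OF assms, of 1 "-1"] quadratic[OF assms, of "-1" 1] by simp

text \<open>Convergence in the semi-norm passes through the form, by the Cauchy--Schwarz inequality.\<close>

lemma tendsto_form:
  assumes "\<And>k. P k \<in> S" "p \<in> S" "r \<in> S"
    and "(\<lambda>k. B (\<lambda>z. P k z - p z) (\<lambda>z. P k z - p z)) \<longlonglongrightarrow> 0"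
  shows "(\<lambda>k. B (P k) r) \<longlonglongrightarrow> B p r"
proof -
  let ?e = "\<lambda>k. B (\<lambda>z. P k z - p z) (\<lambda>z. P k z - p z)"
  have "(\<lambda>k. sqrt (?e k) * sqrt (B r r)) \<longlonglongrightarrow> sqrt 0 * sqrt (B r r)"
    by (intro tendsto_intros assms)
  then have lim: "(\<lambda>k. sqrt (?e k) * sqrt (B r r)) \<longlonglongrightarrow> 0"
    by simp
  have "norm (B (P k) r - B p r) \<le> sqrt (?e k) * sqrt (B r r)" for k
    using Cauchy_Schwarz_sqrt[OF diff_closed[OF assms(1)[of k] assms(2)] assms(3)]
    by (simp add: diff_left assms)
  then have "(\<lambda>k. B (P k) r - B p r) \<longlonglongrightarrow> 0"
    by (rule Lim_null_comparison[OF always_eventually[OF allI] lim])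
  then show ?thesis by (simp add: LIM_zero_iff)
qed

text \<open>
  The representing element is the minimiser of the energy \<open>B p p - 2 \<phi> p\<close>, which is bounded
  below because \<open>\<phi>\<close> is bounded; the parallelogram identity makes every minimising sequence
  Cauchy. The Euler equation of the limit is obtained by comparing \<open>p\<^sub>k + t v\<close> with the infimum
  before passing to the limit, so that continuity of the energy itself never enters.
\<close>

theorem Riesz_representation:
  assumes ne: "S \<noteq> {}"
    and phi_lin: "\<And>p q s t. p \<in> S \<Longrightarrow> q \<in> S \<Longrightarrow>
      \<phi> (\<lambda>z. s *\<^sub>R p z + t *\<^sub>R q z) = s * \<phi> p + t * \<phi> q"
    and phi_bound: "\<And>p. p \<in> S \<Longrightarrow> \<bar>\<phi> p\<bar> \<le> C * sqrt (B p p)"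
    and complete: "\<And>P. (\<And>k::nat. P k \<in> S) \<Longrightarrow>
      (\<And>e. e > 0 \<Longrightarrow> \<exists>N. \<forall>i\<ge>N. \<forall>j\<ge>N. B (\<lambda>z. P i z - P j z) (\<lambda>z. P i z - P j z) < e) \<Longrightarrow>
      \<exists>p\<in>S. (\<lambda>k. B (\<lambda>z. P k z - p z) (\<lambda>z. P k z - p z)) \<longlonglongrightarrow> 0"
  shows "\<exists>p\<in>S. \<forall>v\<in>S. B p v = \<phi> v"
proof -
  define J where "J p = B p p - 2 * \<phi> p" for p
  have J_lin: "J (\<lambda>z. s *\<^sub>R p z + t *\<^sub>R q z)
      = s\<^sup>2 * B p p + 2 * s * t * B p q + t\<^sup>2 * B q q - 2 * s * \<phi> p - 2 * t * \<phi> q"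
    if "p \<in> S" "q \<in> S" for p q s t
    using that by (simp add: J_def quadratic phi_lin algebra_simps)
  have below: "- C\<^sup>2 \<le> J p" if "p \<in> S" for p
  proof -
    have "0 \<le> (sqrt (B p p) - C)\<^sup>2" by simp
    then have "0 \<le> B p p - 2 * (C * sqrt (B p p)) + C\<^sup>2"
      using nonneg[OF that] by (simp add: power2_diff algebra_simps)
    then show ?thesis using phi_bound[OF that] by (simp add: J_def)
  qed
  define m where "m = Inf (J ` S)"
  have bdd: "bdd_below (J ` S)"
    using below by (rule bdd_belowI2)
  have m_le: "m \<le> J p" if "p \<in> S" for p
    unfolding m_def using bdd that by (rule cINF_lower)
  have "\<exists>p\<in>S. J p < m + 1 / real (Suc k)" for k
    using cINF_less_iff[OF ne bdd, of "m + 1 / real (Suc k)"] by (simp add: m_def)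
  then obtain P where P: "\<And>k. P k \<in> S" "\<And>k. J (P k) < m + 1 / real (Suc k)"
    by metis
  have parallelogram: "B (\<lambda>z. P i z - P j z) (\<lambda>z. P i z - P j z)
      \<le> 2 / real (Suc i) + 2 / real (Suc j)" for i j
  proof -
    have "m \<le> J (\<lambda>z. (1/2) *\<^sub>R P i z + (1/2) *\<^sub>R P j z)"
      by (intro m_le lin_closed P)
    then show ?thesis
      using P(2)[of i] P(2)[of j] J_lin[OF P(1) P(1), of "1/2" i "1/2" j]
        quadratic[OF P(1) P(1), of 1 i "-1" j]
      by (simp add: J_def power2_eq_square)
  qed
  have "\<exists>p\<in>S. (\<lambda>k. B (\<lambda>z. P k z - p z) (\<lambda>z. P k z - p z)) \<longlonglongrightarrow> 0"
  proof (rule complete[OF P(1)])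
    fix e :: real assume "e > 0"
    then obtain N where N: "4 / real (Suc N) < e"
      using reals_Archimedean[of "e / 4"] by (auto simp: field_simps)
    have "B (\<lambda>z. P i z - P j z) (\<lambda>z. P i z - P j z) < e" if "i \<ge> N" "j \<ge> N" for i j
    proof -
      have "2 / real (Suc i) \<le> 2 / real (Suc N)" "2 / real (Suc j) \<le> 2 / real (Suc N)"
        using that by (auto intro!: divide_left_mono)
      then show ?thesis using parallelogram[of i j] N by simp
    qed
    then show "\<exists>N. \<forall>i\<ge>N. \<forall>j\<ge>N. B (\<lambda>z. P i z - P j z) (\<lambda>z. P i z - P j z) < e" by blast
  qed
  then obtain p where p: "p \<in> S" and lim: "(\<lambda>k. B (\<lambda>z. P k z - p z) (\<lambda>z. P k z - p z)) \<longlonglongrightarrow> 0"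
    by blast
  have "B p v = \<phi> v" if v: "v \<in> S" for v
  proof -
    have "0 \<le> 0 + 2 * t * (B p v - \<phi> v) + t\<^sup>2 * B v v" for t
    proof (rule LIMSEQ_le_const)
      show "(\<lambda>k. 1 / real (Suc k) + 2 * t * (B (P k) v - \<phi> v) + t\<^sup>2 * B v v)
          \<longlonglongrightarrow> 0 + 2 * t * (B p v - \<phi> v) + t\<^sup>2 * B v v"
        using LIMSEQ_inverse_real_of_nat
        by (intro tendsto_intros tendsto_form P p v lim) (simp add: inverse_eq_divide)
      have "0 \<le> 1 / real (Suc k) + 2 * t * (B (P k) v - \<phi> v) + t\<^sup>2 * B v v" for k
        using m_le[OF lin_closed[OF P(1)[of k] v, of 1 t]] J_lin[OF P(1)[of k] v, of 1 t] P(2)[of k]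
        by (simp add: J_def algebra_simps)
      then show "\<exists>N. \<forall>k\<ge>N. 0 \<le> 1 / real (Suc k) + 2 * t * (B (P k) v - \<phi> v) + t\<^sup>2 * B v v"
        by blast
    qed
    from quadratic_nonneg_imp_discriminant[OF this nonneg[OF v]] show ?thesis by simp
  qed
  then show ?thesis using p by blast
qed

end


section \<open>Square-integrable functions\<close>

abbreviation M :: "(real \<times> real) measure" where "M \<equiv> lebesgue_on D"

text \<open>As a box, \<open>D\<close> meets every other box in a box.\<close>

lemma D_box: "D = box (0, 0) (1, 1)"
  unfolding D_def by (auto simp: box_def Basis_prod_def)

lemma open_D: "open D"
  unfolding D_box by (rule open_box)

lemma sets_D [simp]: "D \<in> sets borel" "D \<in> sets lborel" "D \<in> sets lebesgue"
  using open_D by auto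

interpretation finite_measure M
proof (rule finite_measureI)
  have "emeasure lborel D < \<infinity>"
    unfolding D_box by (rule emeasure_bounded_finite) simp
  then show "emeasure M (space M) \<noteq> \<infinity>"
    by (simp add: space_restrict_space emeasure_restrict_space)
qed

lemma space_M [simp]: "space M = D"
  by (simp add: space_restrict_space)

lemma borel_measurable_M: "h \<in> borel_measurable borel \<Longrightarrow> h \<in> borel_measurable M"
  by (simp add: measurable_completion measurable_restrict_space1)

lemma L2_measurable [measurable_dest]: "g \<in> L2 \<Longrightarrow> g \<in> borel_measurable M"
  by (simp add: L2_def)

lemma L2_square_integrable: "g \<in> L2 \<Longrightarrow> integrable M (\<lambda>z. (norm (g z))\<^sup>2)"
  by (simp add: L2_def)

lemma L2_lin:
  assumes g: "g \<in> L2" and h: "h \<in> L2"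
  shows "(\<lambda>z. s *\<^sub>R g z + t *\<^sub>R h z) \<in> L2"
proof -
  have [measurable]: "g \<in> borel_measurable M" "h \<in> borel_measurable M"
    using g h by (auto intro: L2_measurable)
  have bound: "(norm (x + y))\<^sup>2 \<le> 2 * (norm x)\<^sup>2 + 2 * (norm y)\<^sup>2" for x y :: 'a
    using power_mono[OF norm_triangle_ineq[of x y], of 2] sum_squares_bound[of "norm x" "norm y"]
    by (simp add: power2_sum)
  have "integrable M (\<lambda>z. (norm (s *\<^sub>R g z + t *\<^sub>R h z))\<^sup>2)"
  proof (rule Bochner_Integration.integrable_bound)
    show "integrable M (\<lambda>z. 2 * (s\<^sup>2 * (norm (g z))\<^sup>2) + 2 * (t\<^sup>2 * (norm (h z))\<^sup>2))"
      using g h by (intro Bochner_Integration.integrable_add integrable_mult_right L2_square_integrable)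
    show "AE z in M. norm ((norm (s *\<^sub>R g z + t *\<^sub>R h z))\<^sup>2)
        \<le> norm (2 * (s\<^sup>2 * (norm (g z))\<^sup>2) + 2 * (t\<^sup>2 * (norm (h z))\<^sup>2))"
      using bound[of "s *\<^sub>R g z" "t *\<^sub>R h z" for z] by (intro AE_I2) (simp add: power_mult_distrib)
  qed measurable
  then show ?thesis by (simp add: L2_def)
qed

lemma L2_inner_integrable:
  assumes g: "g \<in> L2" and h: "h \<in> L2"
  shows "integrable M (\<lambda>z. g z \<bullet> h z)"
proof (rule Bochner_Integration.integrable_bound)
  have [measurable]: "g \<in> borel_measurable M" "h \<in> borel_measurable M"
    using g h by (auto intro: L2_measurable)
  show "integrable M (\<lambda>z. (norm (g z))\<^sup>2 + (norm (h z))\<^sup>2)"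
    using g h by (intro Bochner_Integration.integrable_add L2_square_integrable)
  have "\<bar>x \<bullet> y\<bar> \<le> (norm x)\<^sup>2 + (norm y)\<^sup>2" for x y :: 'a
    using Cauchy_Schwarz_ineq2[of x y] sum_squares_bound[of "norm x" "norm y"]
      mult_nonneg_nonneg[OF norm_ge_zero[of x] norm_ge_zero[of y]] by linarith
  then show "AE z in M. norm (g z \<bullet> h z) \<le> norm ((norm (g z))\<^sup>2 + (norm (h z))\<^sup>2)"
    by (intro AE_I2) simp
  show "(\<lambda>z. g z \<bullet> h z) \<in> borel_measurable M" by measurable
qed

abbreviation ip2 :: "(real \<times> real \<Rightarrow> 'b::euclidean_space) \<Rightarrow> (real \<times> real \<Rightarrow> 'b) \<Rightarrow> real" where
  "ip2 g h \<equiv> LINT z|M. g z \<bullet> h z"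

interpretation L2: semi_inner_space "L2 :: (real \<times> real \<Rightarrow> 'b::euclidean_space) set" ip2
proof
  fix p q r :: "real \<times> real \<Rightarrow> 'b" and s t :: real
  assume p: "p \<in> L2" and q: "q \<in> L2"
  show "(\<lambda>z. s *\<^sub>R p z + t *\<^sub>R q z) \<in> L2" using p q by (rule L2_lin)
  show "ip2 p q = ip2 q p" by (simp add: inner_commute)
  assume r: "r \<in> L2"
  show "ip2 (\<lambda>z. s *\<^sub>R p z + t *\<^sub>R q z) r = s * ip2 p r + t * ip2 q r"
    using L2_inner_integrable[OF p r] L2_inner_integrable[OF q r] by (simp add: inner_add_left)
qed simp

lemma ip2_square: "ip2 g g = (LINT z|M. (norm (g z))\<^sup>2)"
  by (simp add: power2_norm_eq_inner)

lemma L2_bounded: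
  assumes "g \<in> borel_measurable M" "\<And>z. z \<in> D \<Longrightarrow> norm (g z) \<le> C"
  shows "g \<in> L2"
proof -
  note [measurable] = assms(1)
  have "integrable M (\<lambda>z. (norm (g z))\<^sup>2)"
    by (rule integrable_const_bound[where B = "C\<^sup>2"]) (auto intro!: power_mono assms AE_I2)
  then show ?thesis by (simp add: L2_def)
qed

lemma L2_norm: "g \<in> L2 \<Longrightarrow> (\<lambda>z. norm (g z)) \<in> L2"
  unfolding L2_def by auto

lemma L2_mult_bounded:
  fixes g :: "real \<times> real \<Rightarrow> 'b::euclidean_space"
  assumes g: "g \<in> L2" and a: "a \<in> borel_measurable M" and bd: "AE z in M. \<bar>a z\<bar> \<le> C"
  shows "(\<lambda>z. a z *\<^sub>R g z) \<in> L2"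
proof -
  have [measurable]: "g \<in> borel_measurable M" "a \<in> borel_measurable M"
    using g a by (auto intro: L2_measurable)
  have "integrable M (\<lambda>z. (norm (a z *\<^sub>R g z))\<^sup>2)"
  proof (rule Bochner_Integration.integrable_bound)
    show "integrable M (\<lambda>z. C\<^sup>2 * (norm (g z))\<^sup>2)"
      by (intro integrable_mult_right L2_square_integrable g)
    show "AE z in M. norm ((norm (a z *\<^sub>R g z))\<^sup>2) \<le> norm (C\<^sup>2 * (norm (g z))\<^sup>2)"
      using bd
    proof eventually_elim
      case (elim z)
      then have "(a z)\<^sup>2 \<le> C\<^sup>2" by (metis abs_ge_zero power2_abs power_mono)
      then show ?case by (simp add: power_mult_distrib mult_right_mono)
    qed
  qed measurable
  then show ?thesis by (simp add: L2_def)
qed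

lemma L2_integrable:
  assumes g: "g \<in> L2" shows "integrable M g"
proof -
  have [measurable]: "g \<in> borel_measurable M" using g by (rule L2_measurable)
  have "integrable M (\<lambda>z. norm (g z))"
    by (rule square_integrable_imp_integrable) (use L2_square_integrable[OF g] in auto)
  then show ?thesis by (simp add: integrable_norm_iff)
qed

text \<open>
  Since \<open>D\<close> has finite measure, a Cauchy sequence in \<open>L\<^sup>2\<close> is Cauchy in \<open>L\<^sup>1\<close> and so has a
  subsequence that converges almost everywhere; Fatou's lemma along that subsequence identifies
  the pointwise limit as the limit in \<open>L\<^sup>2\<close>.
\<close>

theorem L2_complete:
  fixes P :: "nat \<Rightarrow> real \<times> real \<Rightarrow> 'b::euclidean_space"
  assumes P: "\<And>k. P k \<in> L2"
    and cauchy: "\<And>e. e > 0 \<Longrightarrow>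
      \<exists>N. \<forall>i\<ge>N. \<forall>j\<ge>N. ip2 (\<lambda>z. P i z - P j z) (\<lambda>z. P i z - P j z) < e"
  shows "\<exists>p\<in>L2. (\<lambda>k. ip2 (\<lambda>z. P k z - p z) (\<lambda>z. P k z - p z)) \<longlonglongrightarrow> 0"
proof -
  have [measurable]: "P k \<in> borel_measurable M" for k using P by (rule L2_measurable)
  have dL2: "(\<lambda>z. P i z - P j z) \<in> L2" for i j
    by (intro L2.diff_closed P)
  have L1: "(LINT z|M. norm (P i z - P j z))
      \<le> sqrt (ip2 (\<lambda>z. P i z - P j z) (\<lambda>z. P i z - P j z)) * sqrt (ip2 (\<lambda>_. 1::real) (\<lambda>_. 1))" for i j
    using L2.Cauchy_Schwarz_sqrt[OF L2_norm[OF dL2[of i j]] L2_bounded[of "\<lambda>_. 1::real" 1]]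
    by (simp add: power2_norm_eq_inner flip: power2_eq_square)
  obtain r where r: "strict_mono r" and "AE z in M. Cauchy (\<lambda>i. P (r i) z)"
  proof (rule cauchy_L1_AE_cauchy_subseq[of M P])
    show "integrable M (P k)" for k using P by (rule L2_integrable)
    fix e :: real assume "e > 0"
    define c where "c = sqrt (ip2 (\<lambda>_. 1::real) (\<lambda>_. 1)) + 1"
    have "c > 0" unfolding c_def by (simp add: add_nonneg_pos)
    then obtain N where N: "\<And>i j. i \<ge> N \<Longrightarrow> j \<ge> N \<Longrightarrow>
        ip2 (\<lambda>z. P i z - P j z) (\<lambda>z. P i z - P j z) < (e / c)\<^sup>2"
      using cauchy[of "(e / c)\<^sup>2"] \<open>e > 0\<close> by auto
    have "(LINT z|M. norm (P i z - P j z)) < e" if "i \<ge> N" "j \<ge> N" for i j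
    proof -
      have "sqrt (ip2 (\<lambda>z. P i z - P j z) (\<lambda>z. P i z - P j z)) < e / c"
        using real_sqrt_less_mono[OF N[OF that]] \<open>e > 0\<close> \<open>c > 0\<close> by simp
      then have "sqrt (ip2 (\<lambda>z. P i z - P j z) (\<lambda>z. P i z - P j z)) * c < e"
        using \<open>c > 0\<close> by (simp add: pos_less_divide_eq)
      moreover have "sqrt (ip2 (\<lambda>z. P i z - P j z) (\<lambda>z. P i z - P j z)) * sqrt (ip2 (\<lambda>_. 1::real) (\<lambda>_. 1))
        \<le> sqrt (ip2 (\<lambda>z. P i z - P j z) (\<lambda>z. P i z - P j z)) * c"
        unfolding c_def by (intro mult_left_mono) auto
      ultimately show ?thesis using L1[of i j] by linarith
    qed
    then show "\<exists>N. \<forall>i\<ge>N. \<forall>j\<ge>N. (LINT z|M. norm (P i z - P j z)) < e" by blast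
  qed
  then have conv: "AE z in M. convergent (\<lambda>i. P (r i) z)" by (simp add: Cauchy_convergent_iff)
  define p where "p z = lim (\<lambda>i. P (r i) z)" for z
  have [measurable]: "p \<in> borel_measurable M" unfolding p_def by measurable
  have ptw: "AE z in M. (\<lambda>i. P (r i) z) \<longlonglongrightarrow> p z"
    using conv by eventually_elim (simp add: p_def convergent_LIMSEQ_iff)
  have fatou: "(\<integral>\<^sup>+z. ennreal ((norm (P k z - p z))\<^sup>2) \<partial>M) \<le> ennreal e"
    if N: "\<And>i j. i \<ge> N \<Longrightarrow> j \<ge> N \<Longrightarrow> ip2 (\<lambda>z. P i z - P j z) (\<lambda>z. P i z - P j z) < e"
      and "k \<ge> N" for N k e
  proof -
    have "(\<integral>\<^sup>+z. ennreal ((norm (P k z - p z))\<^sup>2) \<partial>M)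
        = (\<integral>\<^sup>+z. liminf (\<lambda>i. ennreal ((norm (P k z - P (r i) z))\<^sup>2)) \<partial>M)"
    proof (rule nn_integral_cong_AE)
      show "AE z in M. ennreal ((norm (P k z - p z))\<^sup>2)
          = liminf (\<lambda>i. ennreal ((norm (P k z - P (r i) z))\<^sup>2))"
        using ptw
      proof eventually_elim
        case (elim z)
        then have "(\<lambda>i. ennreal ((norm (P k z - P (r i) z))\<^sup>2)) \<longlonglongrightarrow> ennreal ((norm (P k z - p z))\<^sup>2)"
          by (intro tendsto_ennrealI tendsto_intros)
        from lim_imp_Liminf[OF sequentially_bot this] show ?case by (rule sym)
      qed
    qed
    also have "\<dots> \<le> liminf (\<lambda>i. \<integral>\<^sup>+z. ennreal ((norm (P k z - P (r i) z))\<^sup>2) \<partial>M)"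
      by (rule nn_integral_liminf) measurable
    also have "\<dots> = liminf (\<lambda>i. ennreal (ip2 (\<lambda>z. P k z - P (r i) z) (\<lambda>z. P k z - P (r i) z)))"
      by (simp add: ip2_square nn_integral_eq_integral L2_square_integrable[OF dL2])
    also have "\<dots> \<le> ennreal e"
    proof (rule Liminf_le)
      show "\<forall>\<^sub>F i in sequentially. ennreal (ip2 (\<lambda>z. P k z - P (r i) z) (\<lambda>z. P k z - P (r i) z)) \<le> ennreal e"
        using eventually_ge_at_top[of N]
      proof eventually_elim
        case (elim i)
        then have "r i \<ge> N" using seq_suble[OF r, of i] by simp
        then show ?case using N[OF \<open>k \<ge> N\<close>] by (intro ennreal_leI) (simp add: less_imp_le)
      qed
    qed simp
    finally show ?thesis .
  qed
  have diff: "(\<lambda>z. P k z - p z) \<in> L2 \<and> ip2 (\<lambda>z. P k z - p z) (\<lambda>z. P k z - p z) \<le> e"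
    if "\<And>i j. i \<ge> N \<Longrightarrow> j \<ge> N \<Longrightarrow> ip2 (\<lambda>z. P i z - P j z) (\<lambda>z. P i z - P j z) < e"
      and "k \<ge> N" "e > 0" for N k e
  proof -
    note F = fatou[OF that(1,2), simplified]
    have int: "integrable M (\<lambda>z. (norm (P k z - p z))\<^sup>2)"
      by (rule integrableI_bounded) (use F in \<open>auto intro: le_less_trans\<close>)
    then show ?thesis
      using F nn_integral_eq_integral[OF int] \<open>e > 0\<close> by (simp add: L2_def ip2_square)
  qed
  obtain N where "\<And>i j. i \<ge> N \<Longrightarrow> j \<ge> N \<Longrightarrow> ip2 (\<lambda>z. P i z - P j z) (\<lambda>z. P i z - P j z) < 1"
    using cauchy[of 1] by auto
  then have "(\<lambda>z. P N z - p z) \<in> L2" using diff[of N 1 N] by simp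
  from L2.diff_closed[OF P[of N] this] have "p \<in> L2" by simp
  moreover have "(\<lambda>k. ip2 (\<lambda>z. P k z - p z) (\<lambda>z. P k z - p z)) \<longlonglongrightarrow> 0"
  proof (rule LIMSEQ_I)
    fix e :: real assume "e > 0"
    then obtain N where "\<And>i j. i \<ge> N \<Longrightarrow> j \<ge> N \<Longrightarrow> ip2 (\<lambda>z. P i z - P j z) (\<lambda>z. P i z - P j z) < e / 2"
      using cauchy[of "e / 2"] by auto
    then have "ip2 (\<lambda>z. P k z - p z) (\<lambda>z. P k z - p z) \<le> e / 2" if "k \<ge> N" for k
      using diff[of N "e / 2" k] that \<open>e > 0\<close> by simp
    then show "\<exists>N. \<forall>k\<ge>N. norm (ip2 (\<lambda>z. P k z - p z) (\<lambda>z. P k z - p z) - 0) < e"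
      using \<open>e > 0\<close> by (intro exI[of _ N]) fastforce
  qed
  ultimately show ?thesis by blast
qed


section \<open>Calculus of test functions\<close>

abbreviation pd :: "real \<times> real \<Rightarrow> (real \<times> real \<Rightarrow> real) \<Rightarrow> real \<times> real \<Rightarrow> real" where
  "pd i \<phi> \<equiv> \<lambda>z. frechet_derivative \<phi> (at z) i"

lemma has_derivative_pd: "\<phi> differentiable (at z) \<Longrightarrow> (\<phi> has_derivative (\<lambda>h. pd h \<phi> z)) (at z)"
  by (simp add: frechet_derivative_works)

lemma Ck_imp_continuous: "Ck k \<phi> \<Longrightarrow> continuous_on UNIV \<phi>"
proof (cases k)
  case (Suc m)
  assume "Ck k \<phi>"
  then show ?thesis
    unfolding Suc by (auto simp: continuous_on_eq_continuous_at differentiable_imp_continuous_within)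
qed simp

lemma Ck_Suc_imp_Ck: "Ck (Suc k) \<phi> \<Longrightarrow> Ck k \<phi>"
proof (induction k arbitrary: \<phi>)
  case 0
  then show ?case using Ck_imp_continuous[of "Suc 0" \<phi>] by simp
next
  case (Suc k)
  then show ?case by (metis Ck.simps(2))
qed

lemma Ck_Suc_imp_differentiable: "Ck (Suc k) \<phi> \<Longrightarrow> \<phi> differentiable (at z)"
  unfolding Ck.simps by blast

lemma Ck_const: "Ck k (\<lambda>z. c)"
  by (induction k arbitrary: c) auto

lemma pd_lin:
  assumes "\<phi> differentiable (at z)" "\<psi> differentiable (at z)"
  shows "pd i (\<lambda>z. s * \<phi> z + t * \<psi> z) z = s * pd i \<phi> z + t * pd i \<psi> z"
proof -
  have "((\<lambda>z. s * \<phi> z + t * \<psi> z) has_derivative (\<lambda>h. s * pd h \<phi> z + t * pd h \<psi> z)) (at z)"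
    by (intro has_derivative_add has_derivative_mult_right has_derivative_pd assms)
  from frechet_derivative_at[OF this] show ?thesis by metis
qed

lemma pd_mult:
  assumes "\<phi> differentiable (at z)" "\<psi> differentiable (at z)"
  shows "pd i (\<lambda>z. \<phi> z * \<psi> z) z = \<phi> z * pd i \<psi> z + pd i \<phi> z * \<psi> z"
proof -
  have "((\<lambda>z. \<phi> z * \<psi> z) has_derivative (\<lambda>h. \<phi> z * pd h \<psi> z + pd h \<phi> z * \<psi> z)) (at z)"
    by (intro has_derivative_mult has_derivative_pd assms)
  from frechet_derivative_at[OF this] show ?thesis by metis
qed

lemma Ck_lin: "Ck k \<phi> \<Longrightarrow> Ck k \<psi> \<Longrightarrow> Ck k (\<lambda>z. s * \<phi> z + t * \<psi> z)"
proof (induction k arbitrary: \<phi> \<psi>)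
  case 0
  then show ?case by (auto intro!: continuous_intros)
next
  case (Suc k)
  then have d: "\<And>z. \<phi> differentiable (at z)" "\<And>z. \<psi> differentiable (at z)" by auto
  have "Ck k (pd i (\<lambda>z. s * \<phi> z + t * \<psi> z))" if "i \<in> Basis" for i
    unfolding pd_lin[OF d] using Suc that by simp
  then show ?case using d by (auto intro!: differentiable_add differentiable_mult)
qed

lemma Ck_mult: "Ck k \<phi> \<Longrightarrow> Ck k \<psi> \<Longrightarrow> Ck k (\<lambda>z. \<phi> z * \<psi> z)"
proof (induction k arbitrary: \<phi> \<psi>)
  case 0
  then show ?case by (auto intro!: continuous_intros)
next
  case (Suc k)
  then have d: "\<And>z. \<phi> differentiable (at z)" "\<And>z. \<psi> differentiable (at z)" by auto
  have "Ck k (pd i (\<lambda>z. \<phi> z * \<psi> z))" if i: "i \<in> Basis" for i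
  proof -
    have "Ck k (pd i \<phi>)" "Ck k (pd i \<psi>)" using Suc.prems i by auto
    then have "Ck k (\<lambda>z. \<phi> z * pd i \<psi> z)" "Ck k (\<lambda>z. pd i \<phi> z * \<psi> z)"
      using Suc.IH Ck_Suc_imp_Ck[OF Suc.prems(1)] Ck_Suc_imp_Ck[OF Suc.prems(2)] by blast+
    from Ck_lin[OF this, of 1 1] show ?thesis unfolding pd_mult[OF d] by simp
  qed
  then show ?case using d by (auto intro!: differentiable_mult)
qed

lemma Ck_prod: "finite I \<Longrightarrow> (\<And>i. i \<in> I \<Longrightarrow> Ck k (\<phi> i)) \<Longrightarrow> Ck k (\<lambda>z. \<Prod>i\<in>I. \<phi> i z)"
  by (induction I rule: finite_induct) (auto intro: Ck_const Ck_mult)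

text \<open>Smooth functions of one affine coordinate; \<open>U n\<close> is the \<open>n\<close>-th derivative of \<open>U 0\<close>.\<close>

lemma Ck_affine:
  assumes "\<And>n t. (U n has_real_derivative U (Suc n) t) (at t)"
  shows "Ck k (\<lambda>z. U n (r * (z \<bullet> b) + s))"
proof (induction k arbitrary: n)
  case 0
  have "continuous_on UNIV (U n)"
    using assms by (auto simp: continuous_on_eq_continuous_at intro: DERIV_isCont)
  then have "continuous_on UNIV (\<lambda>z. U n (r * (z \<bullet> b) + s))"
    by (rule continuous_on_compose2) (auto intro!: continuous_intros)
  then show ?case by simp
next
  case (Suc k)
  have deriv: "((\<lambda>z. U n (r * (z \<bullet> b) + s)) has_derivative
      (\<lambda>h. (r * (h \<bullet> b)) * U (Suc n) (r * (z \<bullet> b) + s))) (at z)" for z :: "real \<times> real"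
  proof (rule DERIV_compose_FDERIV[where f = "U n" and g = "\<lambda>z. r * (z \<bullet> b) + s"])
    show "((\<lambda>z. r * (z \<bullet> b) + s) has_derivative (\<lambda>h. r * (h \<bullet> b))) (at z)"
      by (auto intro!: derivative_eq_intros)
  qed (rule assms)
  then have "pd i (\<lambda>z. U n (r * (z \<bullet> b) + s)) = (\<lambda>z. (r * (i \<bullet> b)) * U (Suc n) (r * (z \<bullet> b) + s))" for i
    using frechet_derivative_at[OF deriv] by metis
  moreover have "Ck k (\<lambda>z. (r * (i \<bullet> b)) * U (Suc n) (r * (z \<bullet> b) + s))" for i
    by (intro Ck_mult Ck_const Suc)
  ultimately show ?case using differentiableI[OF deriv] by (simp del: split_paired_All)
qed

lemma Ck_coordinate: "Ck k (\<lambda>z. z \<bullet> b)"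
proof -
  define U :: "nat \<Rightarrow> real \<Rightarrow> real" where
    "U n t = (if n = 0 then t else if n = 1 then 1 else 0)" for n t
  have "(U n has_real_derivative U (Suc n) t) (at t)" for n t
    by (cases "n = 0"; cases "n = 1") (simp_all add: U_def[abs_def])
  from Ck_affine[of U, OF this, of k 0 1 b 0] show ?thesis by (simp add: U_def)
qed

lemma test_functionsD:
  assumes "\<phi> \<in> test_functions"
  shows "Ck k \<phi>" "\<phi> differentiable (at z)"
proof -
  show Ck: "Ck k \<phi>" for k using assms by (simp add: test_functions_def)
  show "\<phi> differentiable (at z)" using Ck by (rule Ck_Suc_imp_differentiable)
qed

lemma test_functionsI:
  assumes "\<And>k. Ck k \<phi>" and K: "compact K" "K \<subseteq> D" "\<And>z. z \<notin> K \<Longrightarrow> \<phi> z = 0"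
  shows "\<phi> \<in> test_functions"
proof -
  have sub: "closure {z. \<phi> z \<noteq> 0} \<subseteq> K"
    using K by (intro closure_minimal compact_imp_closed) auto
  moreover have "compact (closure {z. \<phi> z \<noteq> 0})"
    using compact_Int_closed[OF K(1) closed_closure, of "{z. \<phi> z \<noteq> 0}"] sub
    by (simp add: Int_absorb1)
  ultimately show ?thesis
    using assms(1) K(2) unfolding test_functions_def by blast
qed

lemma test_functions_support:
  assumes "\<phi> \<in> test_functions"
  obtains K where "compact K" "K \<subseteq> D" "\<And>z. z \<notin> K \<Longrightarrow> \<phi> z = 0"
    "\<And>z i. z \<notin> K \<Longrightarrow> pd i \<phi> z = 0"
proof
  let ?K = "closure {z. \<phi> z \<noteq> 0}"
  show "compact ?K" "?K \<subseteq> D" using assms by (auto simp: test_functions_def)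
  show 0: "\<phi> z = 0" if "z \<notin> ?K" for z
    using that closure_subset[of "{z. \<phi> z \<noteq> 0}"] by auto
  show "pd i \<phi> z = 0" if "z \<notin> ?K" for z i
  proof -
    have "frechet_derivative \<phi> (at z) = frechet_derivative (\<lambda>z. 0) (at z)"
    proof (rule frechet_derivative_transform_within_open[where X = "- ?K"])
      show "\<phi> differentiable (at z)" using assms by (rule test_functionsD)
      show "open (- ?K)" by (intro open_Compl closed_closure)
      show "z \<in> - ?K" using that by simp
      show "\<phi> w = 0" if "w \<in> - ?K" for w using that by (intro 0) blast
    qed
    then show ?thesis by simp
  qed
qed

lemma test_functions_lin:
  assumes "\<phi> \<in> test_functions" "\<psi> \<in> test_functions"
  shows "(\<lambda>z. s * \<phi> z + t * \<psi> z) \<in> test_functions"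
proof -
  obtain K where K: "compact K" "K \<subseteq> D" "\<And>z. z \<notin> K \<Longrightarrow> \<phi> z = 0"
    using test_functions_support[OF assms(1)] by metis
  obtain K' where K': "compact K'" "K' \<subseteq> D" "\<And>z. z \<notin> K' \<Longrightarrow> \<psi> z = 0"
    using test_functions_support[OF assms(2)] by metis
  show ?thesis
  proof (rule test_functionsI[where K = "K \<union> K'"])
    show "Ck k (\<lambda>z. s * \<phi> z + t * \<psi> z)" for k
      using assms by (intro Ck_lin test_functionsD(1))
  qed (use K K' in \<open>auto intro: compact_Un\<close>)
qed

lemma test_functions_mult:
  assumes "\<And>k. Ck k \<psi>" "\<phi> \<in> test_functions"
  shows "(\<lambda>z. \<psi> z * \<phi> z) \<in> test_functions"
proof -
  obtain K where K: "compact K" "K \<subseteq> D" "\<And>z. z \<notin> K \<Longrightarrow> \<phi> z = 0"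
    using test_functions_support[OF assms(2)] by metis
  show ?thesis
  proof (rule test_functionsI[where K = K])
    show "Ck k (\<lambda>z. \<psi> z * \<phi> z)" for k
      by (intro Ck_mult assms(1) test_functionsD(1)[OF assms(2)])
  qed (use K in auto)
qed

lemma test_functions_zero: "(\<lambda>z. 0) \<in> test_functions"
  by (rule test_functionsI[where K = "{}"]) (auto intro: Ck_const)

lemma test_function_continuous:
  assumes "\<phi> \<in> test_functions"
  shows "continuous_on UNIV \<phi>" "i \<in> Basis \<Longrightarrow> continuous_on UNIV (pd i \<phi>)"
  using test_functionsD(1)[OF assms, of "Suc 0"] Ck_imp_continuous[of "Suc 0" \<phi>]
  by (simp_all del: split_paired_All)

lemma compactly_supported_bounded:
  fixes \<psi> :: "real \<times> real \<Rightarrow> real"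
  assumes "continuous_on UNIV \<psi>" "compact K" "\<And>z. z \<notin> K \<Longrightarrow> \<psi> z = 0"
  obtains C where "C \<ge> 0" "\<And>z. \<bar>\<psi> z\<bar> \<le> C"
proof -
  have "bounded (\<psi> ` K)"
    using assms by (intro compact_imp_bounded compact_continuous_image) (auto intro: continuous_on_subset)
  then obtain C where C: "\<And>z. z \<in> K \<Longrightarrow> \<bar>\<psi> z\<bar> \<le> C"
    unfolding bounded_iff by auto
  show thesis
  proof (rule that[of "max C 0"])
    show "\<bar>\<psi> z\<bar> \<le> max C 0" for z
      using C[of z] assms(3)[of z] by (cases "z \<in> K") auto
  qed simp
qed

lemma test_function_L2:
  assumes "\<phi> \<in> test_functions"
  shows "\<phi> \<in> L2" "i \<in> Basis \<Longrightarrow> pd i \<phi> \<in> L2"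
proof -
  obtain K where K: "compact K" "\<And>z. z \<notin> K \<Longrightarrow> \<phi> z = 0" "\<And>z i. z \<notin> K \<Longrightarrow> pd i \<phi> z = 0"
    using test_functions_support[OF assms] by metis
  have *: "\<psi> \<in> L2" if \<psi>: "continuous_on UNIV \<psi>" "\<And>z. z \<notin> K \<Longrightarrow> \<psi> z = 0" for \<psi> :: "real \<times> real \<Rightarrow> real"
  proof -
    obtain C where "\<And>z. \<bar>\<psi> z\<bar> \<le> C"
      using compactly_supported_bounded[OF \<psi>(1) K(1) \<psi>(2)] by metis
    then show ?thesis
      using \<psi>(1) by (intro L2_bounded[of _ C] borel_measurable_M borel_measurable_continuous_onI) auto
  qed
  show "\<phi> \<in> L2"
    using test_function_continuous(1)[OF assms] K(2) by (rule *)
  show "pd i \<phi> \<in> L2" if "i \<in> Basis"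
    using test_function_continuous(2)[OF assms that] K(3) by (rule *)
qed

lemma integral_M_lborel:
  fixes g :: "real \<times> real \<Rightarrow> real"
  assumes "g \<in> borel_measurable borel" "\<And>z. z \<notin> D \<Longrightarrow> g z = 0"
  shows "integral\<^sup>L M g = integral\<^sup>L lborel g"
proof -
  have "(\<lambda>z. indicator D z *\<^sub>R g z) = g"
    using assms(2) by (auto simp: fun_eq_iff indicator_def)
  then show ?thesis
    using assms(1) by (simp add: integral_restrict_space integral_completion)
qed

lemma integral_lborel_translate:
  fixes g :: "'a::euclidean_space \<Rightarrow> real"
  assumes [measurable]: "g \<in> borel_measurable borel"
  shows "(LINT z|lborel. g (c + z)) = (LINT z|lborel. g z)"
  using integral_distr[of "(+) c" lborel borel g] by (simp add: lborel_distr_plus)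

text \<open>
  By translation invariance the difference quotients of \<open>\<phi>\<close> have integral zero, and they are
  bounded and supported in a fixed square, so dominated convergence applies.
\<close>

lemma integral_pd_zero:
  assumes \<phi>: "\<phi> \<in> test_functions" and i: "i \<in> Basis"
  shows "(LINT z|M. pd i \<phi> z) = 0"
proof -
  obtain K where K: "compact K" "K \<subseteq> D" "\<And>z. z \<notin> K \<Longrightarrow> \<phi> z = 0" "\<And>z i. z \<notin> K \<Longrightarrow> pd i \<phi> z = 0"
    using test_functions_support[OF \<phi>] by metis
  obtain C where C: "C \<ge> 0" "\<And>z. \<bar>pd i \<phi> z\<bar> \<le> C"
    using compactly_supported_bounded[OF test_function_continuous(2)[OF \<phi> i] K(1)] K(4) by metis
  have [measurable]: "\<phi> \<in> borel_measurable borel" "pd i \<phi> \<in> borel_measurable borel"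
    using test_function_continuous(1)[OF \<phi>] test_function_continuous(2)[OF \<phi> i]
    by (simp_all only: borel_measurable_continuous_onI)
  have line: "((\<lambda>t. \<phi> (z + t *\<^sub>R i)) has_real_derivative pd i \<phi> (z + t *\<^sub>R i)) (at t)" for z t
  proof -
    have "((\<lambda>t. \<phi> (z + t *\<^sub>R i)) has_derivative (\<lambda>h. pd (h *\<^sub>R i) \<phi> (z + t *\<^sub>R i))) (at t)"
      by (rule has_derivative_compose[where f = "\<lambda>t. z + t *\<^sub>R i" and g = \<phi>])
        (auto intro!: derivative_eq_intros has_derivative_pd test_functionsD \<phi>)
    moreover have "pd (h *\<^sub>R i) \<phi> w = h * pd i \<phi> w" for h w
      using linear_cmul[OF has_derivative_linear[OF has_derivative_pd[OF test_functionsD(2)[OF \<phi>]]]] by simp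
    ultimately show ?thesis by (simp add: has_field_derivative_def mult.commute[of _ "pd i \<phi> _"])
  qed
  define e where "e n = 1 / real (Suc n)" for n
  define q where "q n z = (\<phi> (e n *\<^sub>R i + z) - \<phi> z) / e n" for n z
  have e: "0 < e n" "e n \<le> 1" for n by (auto simp: e_def)
  have q0: "integral\<^sup>L lborel (q n) = 0" for n
  proof -
    have "(\<lambda>z. indicator K z *\<^sub>R \<phi> z) = \<phi>"
      using K(3) by (auto simp: indicator_def fun_eq_iff)
    then have "integrable lborel \<phi>"
      using borel_integrable_compact[OF K(1) continuous_on_subset[OF test_function_continuous(1)[OF \<phi>] subset_UNIV]]
      by simp
    moreover from this have "integrable lborel (\<lambda>z. \<phi> (e n *\<^sub>R i + z))"
      using integrable_distr[of "(+) (e n *\<^sub>R i)" lborel borel \<phi>] by (simp add: lborel_distr_plus)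
    ultimately show ?thesis
      unfolding q_def by (simp add: integral_lborel_translate)
  qed
  define W :: "(real \<times> real) set" where "W = cbox (-1, -1) (1, 1)"
  have "(\<lambda>n. integral\<^sup>L lborel (q n)) \<longlonglongrightarrow> integral\<^sup>L lborel (pd i \<phi>)"
  proof (rule integral_dominated_convergence[where w = "\<lambda>z. C * indicator W z"])
    have "emeasure lborel W < \<infinity>" unfolding W_def by (rule emeasure_bounded_finite) simp
    then show "integrable lborel (\<lambda>z. C * indicator W z :: real)"
      unfolding W_def by (intro integrable_mult_right integrable_real_indicator) auto
    show "AE z in lborel. norm (q n z) \<le> C * indicator W z" for n
    proof (rule AE_I2)
      fix z
      have "norm (\<phi> (z + e n *\<^sub>R i) - \<phi> (z + 0 *\<^sub>R i)) \<le> C * norm (e n - 0)"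
        by (rule field_differentiable_bound[where S = UNIV and f' = "\<lambda>t. pd i \<phi> (z + t *\<^sub>R i)"])
          (use line C in auto)
      then have "\<bar>\<phi> (e n *\<^sub>R i + z) - \<phi> z\<bar> \<le> C * e n"
        using e(1)[of n] by (simp add: add.commute)
      then have "norm (q n z) \<le> C"
        using e(1)[of n] by (simp add: q_def abs_divide divide_le_eq)
      moreover have "q n z = 0" if "z \<notin> W"
      proof -
        have "z \<notin> D" "e n *\<^sub>R i + z \<notin> D"
          using that i e[of n] unfolding W_def D_def by (cases z, auto simp: Basis_prod_def cbox_Pair_eq)+
        then have "\<phi> z = 0" "\<phi> (e n *\<^sub>R i + z) = 0" using K(2) by (blast intro: K(3))+
        then show ?thesis by (simp add: q_def)
      qed
      ultimately show "norm (q n z) \<le> C * indicator W z" by (auto simp: indicator_def)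
    qed
    show "AE z in lborel. (\<lambda>n. q n z) \<longlonglongrightarrow> pd i \<phi> z"
    proof (rule AE_I2)
      fix z
      have "((\<lambda>h. (\<phi> (z + (0 + h) *\<^sub>R i) - \<phi> (z + 0 *\<^sub>R i)) / h) \<longlongrightarrow> pd i \<phi> (z + 0 *\<^sub>R i)) (at 0)"
        using line[of z 0] unfolding DERIV_def .
      moreover have "filterlim e (at 0) sequentially"
        using LIMSEQ_inverse_real_of_nat
        by (auto simp: filterlim_at e_def[abs_def] inverse_eq_divide)
      ultimately have "((\<lambda>n. (\<phi> (z + (0 + e n) *\<^sub>R i) - \<phi> (z + 0 *\<^sub>R i)) / e n) \<longlongrightarrow> pd i \<phi> (z + 0 *\<^sub>R i)) sequentially"
        by (rule filterlim_compose)
      then show "(\<lambda>n. q n z) \<longlonglongrightarrow> pd i \<phi> z"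
        by (simp add: q_def add.commute)
    qed
  qed (unfold q_def, measurable)
  then have "integral\<^sup>L lborel (pd i \<phi>) = 0"
    by (simp add: q0 LIMSEQ_const_iff)
  then show ?thesis
    using integral_M_lborel[of "pd i \<phi>"] K(4) subsetD[OF K(2)]
    by (metis \<open>pd i \<phi> \<in> borel_measurable borel\<close>)
qed

lemma integration_by_parts:
  assumes \<phi>: "\<phi> \<in> test_functions" and \<psi>: "\<And>k. Ck k \<psi>" and i: "i \<in> Basis"
  shows "(LINT z|M. \<psi> z * pd i \<phi> z + pd i \<psi> z * \<phi> z) = 0"
proof -
  have "pd i (\<lambda>z. \<psi> z * \<phi> z) = (\<lambda>z. \<psi> z * pd i \<phi> z + pd i \<psi> z * \<phi> z)"
    by (intro ext pd_mult test_functionsD \<phi> Ck_Suc_imp_differentiable[OF \<psi>])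
  with integral_pd_zero[OF test_functions_mult[OF \<psi> \<phi>] i] show ?thesis by simp
qed


section \<open>Bump functions and the fundamental lemma of the calculus of variations\<close>

text \<open>
  The functions that arise as derivatives of \<open>exp (- 1 / t)\<close>, extended by zero to \<open>t \<le> 0\<close>; the
  function itself is the case \<open>p = 1\<close>.
\<close>

definition flat :: "real poly \<Rightarrow> real \<Rightarrow> real" where
  "flat p t = (if t > 0 then poly p (1 / t) * exp (- (1 / t)) else 0)"

lemma poly_div_exp_tendsto_0: "((\<lambda>s. poly p s / exp s) \<longlongrightarrow> (0::real)) at_top"
proof -
  have "((\<lambda>s. \<Sum>k\<le>degree p. coeff p k * (s ^ k / exp s)) \<longlongrightarrow> (\<Sum>k\<le>degree p. coeff p k * 0)) at_top"
    by (intro tendsto_intros tendsto_power_div_exp_0)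
  then show ?thesis by (simp add: poly_altdef sum_divide_distrib)
qed

text \<open>
  For \<open>t > 0\<close> this is the chain rule. At \<open>t = 0\<close> the difference quotient from the right is
  \<open>s * p s / exp s\<close> with \<open>s = 1 / t\<close>, and the exponential beats every polynomial.
\<close>

lemma flat_deriv: "(flat p has_real_derivative flat ([:0, 0, 1:] * (p - pderiv p)) t) (at t)"
proof -
  consider "t < 0" | "t = 0" | "t > 0" by linarith
  then show ?thesis
  proof cases
    assume "t < 0"
    then have "((\<lambda>t. 0) has_real_derivative flat ([:0, 0, 1:] * (p - pderiv p)) t) (at t)"
      by (simp add: flat_def)
    then show ?thesis
      by (rule has_field_derivative_transform_within_open[where S = "{..<0}"])
        (use \<open>t < 0\<close> in \<open>auto simp: flat_def\<close>)
  next
    assume "t > 0"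
    then have "((\<lambda>t. poly p (1 / t) * exp (- (1 / t))) has_real_derivative
        flat ([:0, 0, 1:] * (p - pderiv p)) t) (at t)"
      by (auto intro!: derivative_eq_intros simp: flat_def field_simps power2_eq_square)
    then show ?thesis
      by (rule has_field_derivative_transform_within_open[where S = "{0<..}"])
        (use \<open>t > 0\<close> in \<open>auto simp: flat_def\<close>)
  next
    assume "t = 0"
    have "((\<lambda>h. flat p h / h) \<longlongrightarrow> 0) (at 0)"
      unfolding filterlim_at_split
    proof
      show "((\<lambda>h. flat p h / h) \<longlongrightarrow> 0) (at_left 0)"
        by (rule tendsto_eventually) (auto simp: eventually_at_filter flat_def)
      have "((\<lambda>s. poly (pCons 0 p) s / exp s) \<longlongrightarrow> 0) at_top"
        by (rule poly_div_exp_tendsto_0)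
      moreover have "\<forall>\<^sub>F s in at_top. poly (pCons 0 p) s / exp s = flat p (inverse s) / inverse s"
        using eventually_gt_at_top[of 0]
        by eventually_elim (simp add: flat_def exp_minus divide_inverse)
      ultimately show "((\<lambda>h. flat p h / h) \<longlongrightarrow> 0) (at_right 0)"
        unfolding filterlim_at_right_to_top by (rule Lim_transform_eventually)
    qed
    then show ?thesis using \<open>t = 0\<close> by (simp add: has_field_derivative_iff flat_def)
  qed
qed

lemma Ck_flat: "Ck k (\<lambda>z. flat p (r * (z \<bullet> b) + s))"
proof -
  define P where "P n = ((\<lambda>q. [:0, 0, 1:] * (q - pderiv q)) ^^ n) p" for n
  have "(flat (P n) has_real_derivative flat (P (Suc n)) t) (at t)" for n t
    using flat_deriv[of "P n" t] by (simp add: P_def)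
  from Ck_affine[of "\<lambda>n. flat (P n)", OF this, of k 0] show ?thesis by (simp add: P_def)
qed

abbreviation bump1 :: "real \<Rightarrow> real" where "bump1 \<equiv> flat 1"

text \<open>
  A smooth approximation of the indicator of the open box from \<open>l\<close> to \<open>u\<close>.
  The shift by \<open>1\<close> keeps the support of the \<open>k\<close>-th bump at distance \<open>1 / k\<close> from the boundary of
  the box, so that a box touching the boundary of \<open>D\<close> is allowed.
\<close>

definition box_bump :: "real \<times> real \<Rightarrow> real \<times> real \<Rightarrow> nat \<Rightarrow> real \<times> real \<Rightarrow> real" where
  "box_bump l u k z = (\<Prod>i\<in>Basis. bump1 (real k * (z \<bullet> i) + (- real k * (l \<bullet> i) - 1)) *
     bump1 (- real k * (z \<bullet> i) + (real k * (u \<bullet> i) - 1)))"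

lemma bump1_bounds: "0 \<le> bump1 t" "bump1 t \<le> 1"
  by (auto simp: flat_def)

lemma box_bump_bounds: "0 \<le> box_bump l u k z" "box_bump l u k z \<le> 1"
  unfolding box_bump_def by (auto intro!: prod_nonneg prod_le_1 mult_le_one mult_nonneg_nonneg bump1_bounds)

lemma box_bump_test_function:
  assumes "box l u \<subseteq> D"
  shows "box_bump l u k \<in> test_functions"
proof -
  \<comment> \<open>The vector with all components \<open>1 / k\<close>, by which the box is shrunk on each side; the bump of
    index \<open>0\<close> is identically zero.\<close>
  define e where "e = (\<Sum>i\<in>Basis. (1 / real k) *\<^sub>R i :: real \<times> real)"
  have e: "e \<bullet> i = 1 / real k" if "i \<in> Basis" for i
    unfolding e_def using that by (rule inner_sum_left_Basis)
  define K where "K = (if k = 0 then {} else cbox (l + e) (u - e))"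
  show ?thesis
  proof (rule test_functionsI)
    show "Ck m (box_bump l u k)" for m
      unfolding box_bump_def by (intro Ck_prod Ck_mult Ck_flat finite_Basis)
    show "compact K" by (simp add: K_def)
    have "K \<subseteq> box l u"
    proof (cases "k = 0")
      case False
      have "l \<bullet> i < z \<bullet> i \<and> z \<bullet> i < u \<bullet> i"
        if "l \<bullet> i + e \<bullet> i \<le> z \<bullet> i" "z \<bullet> i \<le> u \<bullet> i - e \<bullet> i" "i \<in> Basis" for z i
      proof -
        have "e \<bullet> i > 0" using e[OF that(3)] False by simp
        with that show ?thesis by linarith
      qed
      then show ?thesis
        by (simp add: K_def False subset_iff mem_box inner_add_left inner_diff_left del: split_paired_All)
    qed (simp add: K_def)
    then show "K \<subseteq> D" using assms by blast
    show "box_bump l u k z = 0" if "z \<notin> K" for z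
    proof -
      have "\<exists>i\<in>Basis. k = 0 \<or> z \<bullet> i < l \<bullet> i + e \<bullet> i \<or> u \<bullet> i - e \<bullet> i < z \<bullet> i"
      proof (cases "k = 0")
        case True
        then show ?thesis using nonempty_Basis by blast
      next
        case False
        then show ?thesis
          using that unfolding K_def by (simp add: mem_box inner_add_left inner_diff_left not_le)
      qed
      then obtain i where i: "i \<in> Basis" "k = 0 \<or> z \<bullet> i < l \<bullet> i + e \<bullet> i \<or> u \<bullet> i - e \<bullet> i < z \<bullet> i"
        by blast
      then have "real k * (z \<bullet> i) + (- real k * (l \<bullet> i) - 1) \<le> 0
          \<or> - real k * (z \<bullet> i) + (real k * (u \<bullet> i) - 1) \<le> 0"
        using e[of i] by (cases "k = 0") (auto simp: field_simps)
      then have "bump1 (real k * (z \<bullet> i) + (- real k * (l \<bullet> i) - 1)) *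
          bump1 (- real k * (z \<bullet> i) + (real k * (u \<bullet> i) - 1)) = 0"
        by (auto simp: flat_def)
      then show ?thesis
        unfolding box_bump_def using i(1) by (intro prod_zero) auto
    qed
  qed
qed

lemma bump1_tendsto:
  assumes "c > 0"
  shows "(\<lambda>k. bump1 (real k * c - 1)) \<longlonglongrightarrow> 1"
proof -
  have lim: "filterlim (\<lambda>k. real k * c - 1) at_top sequentially"
    unfolding filterlim_at_top_gt[where c = 0]
  proof (intro allI impI)
    fix Z :: real
    show "\<forall>\<^sub>F k in sequentially. Z \<le> real k * c - 1"
      using eventually_ge_at_top[of "nat \<lceil>(Z + 1) / c\<rceil>"]
      by eventually_elim (use assms in \<open>simp add: nat_le_iff ceiling_le_iff field_simps\<close>)
  qed
  have "((\<lambda>t. exp (- (1 / t))) \<longlongrightarrow> exp (- (0::real))) at_top"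
    by (intro tendsto_intros tendsto_divide_0[OF tendsto_const]
        filterlim_at_top_imp_at_infinity filterlim_ident)
  then have "((\<lambda>t. exp (- (1 / t))) \<longlongrightarrow> (1::real)) at_top" by simp
  then have "(bump1 \<longlongrightarrow> 1) at_top"
    by (rule Lim_transform_eventually)
      (use eventually_gt_at_top[of "0::real"] in \<open>auto elim!: eventually_mono simp: flat_def\<close>)
  then show ?thesis using lim by (rule filterlim_compose)
qed

lemma box_bump_tendsto: "(\<lambda>k. box_bump l u k z) \<longlonglongrightarrow> indicator (box l u) z"
proof (cases "z \<in> box l u")
  case True
  have "(\<lambda>k. box_bump l u k z) \<longlonglongrightarrow> (\<Prod>i\<in>(Basis :: (real \<times> real) set). 1 * 1)"
    unfolding box_bump_def
  proof (intro tendsto_prod tendsto_mult)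
    fix i :: "real \<times> real" assume "i \<in> Basis"
    then have "z \<bullet> i - l \<bullet> i > 0" "u \<bullet> i - z \<bullet> i > 0" using True by (auto simp: mem_box)
    from bump1_tendsto[OF this(1)] bump1_tendsto[OF this(2)]
    show "(\<lambda>k. bump1 (real k * (z \<bullet> i) + (- real k * (l \<bullet> i) - 1))) \<longlonglongrightarrow> 1"
      "(\<lambda>k. bump1 (- real k * (z \<bullet> i) + (real k * (u \<bullet> i) - 1))) \<longlonglongrightarrow> 1"
      by (simp_all add: algebra_simps)
  qed
  then show ?thesis using True by simp
next
  case False
  have "box_bump l u k z = 0" for k
  proof -
    obtain i where i: "i \<in> Basis" "z \<bullet> i \<le> l \<bullet> i \<or> u \<bullet> i \<le> z \<bullet> i"
      using False by (auto simp: mem_box not_less)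
    then have "real k * (z \<bullet> i) \<le> real k * (l \<bullet> i) \<or> real k * (u \<bullet> i) \<le> real k * (z \<bullet> i)"
      by (auto intro: mult_left_mono)
    then have "bump1 (real k * (z \<bullet> i) + (- real k * (l \<bullet> i) - 1)) *
        bump1 (- real k * (z \<bullet> i) + (real k * (u \<bullet> i) - 1)) = 0"
      by (auto simp: flat_def)
    then show ?thesis
      unfolding box_bump_def using i(1) by (intro prod_zero) auto
  qed
  then show ?thesis using False by simp
qed

text \<open>
  A function orthogonal to all test functions has integral zero over every box, because
  the indicator of a box is a bounded pointwise limit of bumps; the sets over which its integral
  is zero form a Dynkin system, so they include all Borel sets.
\<close>

theorem fundamental_lemma:
  fixes g :: "real \<times> real \<Rightarrow> real"
  assumes g: "integrable M g" and orth: "\<And>\<phi>. \<phi> \<in> test_functions \<Longrightarrow> (LINT z|M. g z * \<phi> z) = 0"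
  shows "AE z in M. g z = 0"
proof -
  have [measurable]: "g \<in> borel_measurable M" using g by simp
  have M_borel: "A \<inter> D \<in> sets M" if "A \<in> sets borel" for A :: "(real \<times> real) set"
    using that by (auto simp: sets_restrict_space)
  have ind_meas: "indicator A \<in> borel_measurable M" if "A \<in> sets borel" for A :: "(real \<times> real) set"
    using that by (intro borel_measurable_M borel_measurable_indicator)
  define I where "I A = (LINT z|M. indicator A z *\<^sub>R g z)" for A :: "(real \<times> real) set"
  have box_in_D: "I (box l u) = 0" if "box l u \<subseteq> D" for l u
  proof -
    have "(\<lambda>k. LINT z|M. g z * box_bump l u k z) \<longlonglongrightarrow> (LINT z|M. g z * indicator (box l u) z)"
    proof (rule integral_dominated_convergence[where w = "\<lambda>z. norm (g z)"])
      have "box_bump l u k \<in> borel_measurable M" for k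
        using test_function_L2(1)[OF box_bump_test_function[OF that]] by (rule L2_measurable)
      then show "(\<lambda>z. g z * box_bump l u k z) \<in> borel_measurable M" for k
        by (intro borel_measurable_times) auto
      show "(\<lambda>z. g z * indicator (box l u) z) \<in> borel_measurable M"
        by (intro borel_measurable_times ind_meas) auto
      show "AE z in M. norm (g z * box_bump l u k z) \<le> norm (g z)" for k
        using box_bump_bounds by (intro AE_I2) (simp add: abs_mult mult_left_le)
    qed (use g in \<open>auto intro!: tendsto_intros box_bump_tendsto\<close>)
    then show ?thesis
      using orth[OF box_bump_test_function[OF that]]
      by (simp add: LIMSEQ_const_iff I_def mult.commute)
  qed
  have I_D: "I (A \<inter> D) = I A" for A
    unfolding I_def by (intro Bochner_Integration.integral_cong) (auto simp: indicator_def)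
  have I_box: "I (box l u) = 0" for l u
  proof -
    obtain l' u' where "box l u \<inter> D = box l' u'"
      unfolding D_box box_Int_box by blast
    then show ?thesis using box_in_D[of l' u'] I_D[of "box l u"] by (metis Int_lower2)
  qed
  have I_borel: "I A = 0" if "A \<in> sets borel" for A
  proof -
    have gen: "A \<in> sigma_sets UNIV (range (\<lambda>(a, b). box a b))"
      using that unfolding borel_eq_box by simp
    have stable: "Int_stable (range (\<lambda>(a, b). box a b :: (real \<times> real) set))"
      by (auto simp: Int_stable_def box_Int_box)
    have borel_gen: "sigma_sets UNIV (range (\<lambda>(a, b). box a b)) = sets (borel :: (real \<times> real) measure)"
      unfolding borel_eq_box by simp
    have int: "integrable M (\<lambda>z. indicator A z *\<^sub>R g z)" if "A \<in> sets borel" for A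
    proof (rule Bochner_Integration.integrable_bound[OF g])
      show "(\<lambda>z. indicator A z *\<^sub>R g z) \<in> borel_measurable M"
        using ind_meas[OF that] by measurable
    qed (auto simp: indicator_def)
    have pow: "range (\<lambda>(a, b). box a b :: (real \<times> real) set) \<subseteq> Pow UNIV" by simp
    show ?thesis
      using stable pow gen
    proof (induction rule: sigma_sets_induct_disjoint)
      case (basic A)
      then show ?case using I_box by auto
    next
      case empty
      then show ?case by (simp add: I_def)
    next
      case (compl A)
      then have A: "A \<in> sets borel" by (simp add: borel_gen)
      have "I A + I (UNIV - A) = (LINT z|M. indicator A z *\<^sub>R g z + indicator (UNIV - A) z *\<^sub>R g z)"
        unfolding I_def using A by (intro Bochner_Integration.integral_add[symmetric] int) auto
      also have "\<dots> = I UNIV"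
        unfolding I_def by (intro Bochner_Integration.integral_cong) (auto simp: indicator_def)
      finally have "I A + I (UNIV - A) = I UNIV" .
      moreover have "I UNIV = 0" using I_D[of UNIV] I_box[of "(0,0)" "(1,1)"] by (simp add: D_box)
      ultimately show ?case using compl by simp
    next
      case (union A)
      then have A: "\<And>i. A i \<in> sets borel" by (auto simp: borel_gen)
      have "I (\<Union>i. A i) = I (\<Union>i. A i \<inter> D)" using I_D[of "\<Union>i. A i"] by simp
      also have "\<dots> = (\<Sum>i. I (A i \<inter> D))"
        unfolding I_def set_lebesgue_integral_def[symmetric]
      proof (rule lebesgue_integral_countable_add)
        show "A i \<inter> D \<in> sets M" for i using A by (rule M_borel)
        show "(A i \<inter> D) \<inter> (A j \<inter> D) = {}" if "i \<noteq> j" for i j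
          using union(1) that by (auto simp: disjoint_family_on_def)
        show "set_integrable M (\<Union>i. A i \<inter> D) g"
          unfolding set_integrable_def using A by (intro int) auto
      qed
      also have "\<dots> = 0" using union(3) by (simp add: I_D)
      finally show ?case .
    qed
  qed
  show ?thesis
  proof (rule density_unique_real[OF g, of "\<lambda>z. 0", simplified])
    fix A assume "A \<in> sets M"
    \<comment> \<open>A Lebesgue measurable set differs from a Borel set by a null set.\<close>
    then have "A \<in> sets lebesgue" by (auto simp: sets_restrict_space)
    then obtain C T where C: "fsigma C" "T \<in> null_sets lebesgue" "C \<union> T = A"
      using lebesgue_set_almost_fsigma by metis
    have "C \<in> sets borel" using C(1) by (auto elim!: fsigma.cases)
    have "T \<inter> D \<in> null_sets M"
      using null_set_Int2[OF C(2), of D] by (simp add: null_sets_restrict_space)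
    then have "AE z in M. z \<notin> T \<inter> D" by (rule AE_not_in)
    have "(LINT z:A|M. g z) = I C"
      unfolding set_lebesgue_integral_def I_def
    proof (rule integral_cong_AE)
      show "AE z in M. indicat_real A z *\<^sub>R g z = indicat_real C z *\<^sub>R g z"
        using \<open>AE z in M. z \<notin> T \<inter> D\<close> AE_space
        by eventually_elim (use C(3) in \<open>auto simp: indicator_def\<close>)
      show "(\<lambda>z. indicat_real A z *\<^sub>R g z) \<in> borel_measurable M"
        using \<open>A \<in> sets M\<close> by measurable
      show "(\<lambda>z. indicat_real C z *\<^sub>R g z) \<in> borel_measurable M"
        using ind_meas[OF \<open>C \<in> sets borel\<close>] by measurable
    qed
    then show "(LINT z:A|M. g z) = 0" using I_borel[OF \<open>C \<in> sets borel\<close>] by simp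
  qed
qed


section \<open>Weak gradients\<close>

lemma L2_component:
  fixes g :: "real \<times> real \<Rightarrow> real \<times> real"
  assumes "g \<in> L2" shows "(\<lambda>z. g z \<bullet> i) \<in> L2"
proof -
  have [measurable]: "g \<in> borel_measurable M" using assms by (rule L2_measurable)
  have "integrable M (\<lambda>z. (norm (g z \<bullet> i))\<^sup>2)"
  proof (rule Bochner_Integration.integrable_bound)
    show "integrable M (\<lambda>z. (norm i)\<^sup>2 * (norm (g z))\<^sup>2)"
      by (intro integrable_mult_right L2_square_integrable assms)
    have "(norm (x \<bullet> i))\<^sup>2 \<le> (norm i)\<^sup>2 * (norm x)\<^sup>2" for x :: "real \<times> real"
      using power_mono[OF Cauchy_Schwarz_ineq2[of x i] abs_ge_zero, of 2]
      by (simp add: power_mult_distrib mult.commute)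
    then show "AE z in M. norm ((norm (g z \<bullet> i))\<^sup>2) \<le> norm ((norm i)\<^sup>2 * (norm (g z))\<^sup>2)"
      by (intro AE_I2) simp
  qed measurable
  then show ?thesis by (simp add: L2_def)
qed

lemma L2_mult_integrable: "p \<in> L2 \<Longrightarrow> q \<in> L2 \<Longrightarrow> integrable M (\<lambda>z. p z * q z :: real)"
  using L2_inner_integrable[of p q] by simp

lemma has_weak_gradientD:
  assumes "has_weak_gradient p g" "\<phi> \<in> test_functions" "i \<in> Basis"
  shows "(LINT z|M. p z * pd i \<phi> z) = - (LINT z|M. (g z \<bullet> i) * \<phi> z)"
  using assms unfolding has_weak_gradient_def by blast

lemma weak_gradient_unique:
  assumes g: "g \<in> L2" "has_weak_gradient p g" and h: "h \<in> L2" "has_weak_gradient p h"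
  shows "AE z in M. g z = h z"
proof -
  have comp: "AE z in M. (g z - h z) \<bullet> i = 0" if i: "i \<in> Basis" for i
  proof (rule fundamental_lemma)
    show "integrable M (\<lambda>z. (g z - h z) \<bullet> i)"
      by (intro L2_integrable L2_component L2.diff_closed g h)
    fix \<phi> assume \<phi>: "\<phi> \<in> test_functions"
    have "integrable M (\<lambda>z. (g z \<bullet> i) * \<phi> z)" "integrable M (\<lambda>z. (h z \<bullet> i) * \<phi> z)"
      by (intro L2_mult_integrable L2_component g h test_function_L2 \<phi>)+
    then show "(LINT z|M. ((g z - h z) \<bullet> i) * \<phi> z) = 0"
      using has_weak_gradientD[OF g(2) \<phi> i] has_weak_gradientD[OF h(2) \<phi> i]
      by (simp add: inner_diff_left left_diff_distrib)
  qed
  have "AE z in M. \<forall>i\<in>Basis. (g z - h z) \<bullet> i = 0"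
    using comp by (intro AE_finite_allI) auto
  then show ?thesis
    by eventually_elim (simp add: euclidean_eq_iff[of "g _"] inner_diff_left)
qed

lemma has_weak_gradient_lin:
  assumes "p \<in> L2" "q \<in> L2" "g \<in> L2" "h \<in> L2"
    and "has_weak_gradient p g" "has_weak_gradient q h"
  shows "has_weak_gradient (\<lambda>z. s * p z + t * q z) (\<lambda>z. s *\<^sub>R g z + t *\<^sub>R h z)"
  unfolding has_weak_gradient_def
proof (intro ballI)
  fix \<phi> and i :: "real \<times> real" assume \<phi>: "\<phi> \<in> test_functions" and i: "i \<in> Basis"
  have int: "integrable M (\<lambda>z. p z * pd i \<phi> z)" "integrable M (\<lambda>z. q z * pd i \<phi> z)"
    "integrable M (\<lambda>z. (g z \<bullet> i) * \<phi> z)" "integrable M (\<lambda>z. (h z \<bullet> i) * \<phi> z)"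
    by (intro L2_mult_integrable L2_component assms test_function_L2 \<phi> i)+
  have "(LINT z|M. (s * p z + t * q z) * pd i \<phi> z)
      = s * (LINT z|M. p z * pd i \<phi> z) + t * (LINT z|M. q z * pd i \<phi> z)"
    using int by (simp add: distrib_right mult.assoc)
  also have "\<dots> = - (s * (LINT z|M. (g z \<bullet> i) * \<phi> z) + t * (LINT z|M. (h z \<bullet> i) * \<phi> z))"
    using assms(5,6)[THEN has_weak_gradientD, OF \<phi> i] by simp
  also have "\<dots> = - (LINT z|M. ((s *\<^sub>R g z + t *\<^sub>R h z) \<bullet> i) * \<phi> z)"
    using int by (simp add: inner_add_left distrib_right mult.assoc)
  finally show "(LINT z|M. (s * p z + t * q z) * pd i \<phi> z)
      = - (LINT z|M. ((s *\<^sub>R g z + t *\<^sub>R h z) \<bullet> i) * \<phi> z)" .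
qed

text \<open>
  Against a fixed test function, both sides of the defining identity are \<open>L\<^sup>2\<close> inner products with
  a fixed square-integrable function, hence continuous.
\<close>

lemma has_weak_gradient_limit:
  assumes P: "\<And>k::nat. P k \<in> L2" "p \<in> L2" and g: "\<And>k. g k \<in> L2" "h \<in> L2"
    and wg: "\<And>k. has_weak_gradient (P k) (g k)"
    and limP: "(\<lambda>k. ip2 (\<lambda>z. P k z - p z) (\<lambda>z. P k z - p z)) \<longlonglongrightarrow> 0"
    and limg: "(\<lambda>k. ip2 (\<lambda>z. g k z - h z) (\<lambda>z. g k z - h z)) \<longlonglongrightarrow> 0"
  shows "has_weak_gradient p h"
  unfolding has_weak_gradient_def
proof (intro ballI)
  fix \<phi> and i :: "real \<times> real" assume \<phi>: "\<phi> \<in> test_functions" and i: "i \<in> Basis"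
  obtain K where K: "compact K" "\<And>z. z \<notin> K \<Longrightarrow> \<phi> z = 0"
    using test_functions_support[OF \<phi>] by metis
  obtain C where C: "\<And>z. \<bar>\<phi> z\<bar> \<le> C"
    using compactly_supported_bounded[OF test_function_continuous(1)[OF \<phi>] K] by metis
  have [measurable]: "\<phi> \<in> borel_measurable M"
    using test_function_L2(1)[OF \<phi>] by (rule L2_measurable)
  have "(\<lambda>z. \<phi> z *\<^sub>R i) \<in> L2"
  proof (rule L2_bounded)
    show "norm (\<phi> z *\<^sub>R i) \<le> C" for z using C[of z] i by simp
  qed measurable
  from L2.tendsto_form[OF g this limg]
  have "(\<lambda>k. - (LINT z|M. (g k z \<bullet> i) * \<phi> z)) \<longlonglongrightarrow> - (LINT z|M. (h z \<bullet> i) * \<phi> z)"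
    by (intro tendsto_minus) (simp add: mult.commute)
  moreover have "(\<lambda>k. LINT z|M. P k z * pd i \<phi> z) \<longlonglongrightarrow> (LINT z|M. p z * pd i \<phi> z)"
    using L2.tendsto_form[OF P test_function_L2(2)[OF \<phi> i] limP] by simp
  ultimately show "(LINT z|M. p z * pd i \<phi> z) = - (LINT z|M. (h z \<bullet> i) * \<phi> z)"
    unfolding has_weak_gradientD[OF wg \<phi> i] by (rule LIMSEQ_unique[rotated])
qed

lemma H1I: "p \<in> L2 \<Longrightarrow> g \<in> L2 \<Longrightarrow> has_weak_gradient p g \<Longrightarrow> p \<in> H1"
  unfolding H1_def by blast

lemma H1_imp_L2: "p \<in> H1 \<Longrightarrow> p \<in> L2"
  unfolding H1_def by blast

lemma wgrad:
  assumes "p \<in> H1" shows "wgrad p \<in> L2" "has_weak_gradient p (wgrad p)"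
proof -
  have "\<exists>g. g \<in> L2 \<and> has_weak_gradient p g" using assms unfolding H1_def by blast
  from someI_ex[OF this] show "wgrad p \<in> L2" "has_weak_gradient p (wgrad p)"
    by (simp_all add: wgrad_def)
qed

lemma wgrad_eqI:
  assumes "p \<in> L2" "g \<in> L2" "has_weak_gradient p g"
  shows "AE z in M. wgrad p z = g z"
  using assms wgrad[OF H1I[OF assms]] by (intro weak_gradient_unique)

lemma H1_lin:
  assumes "p \<in> H1" "q \<in> H1"
  shows "(\<lambda>z. s * p z + t * q z) \<in> H1"
    and "AE z in M. wgrad (\<lambda>z. s * p z + t * q z) z = s *\<^sub>R wgrad p z + t *\<^sub>R wgrad q z"
proof -
  have "(\<lambda>z. s * p z + t * q z) \<in> L2"
    using L2_lin[OF assms[THEN H1_imp_L2]] by simp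
  moreover have "(\<lambda>z. s *\<^sub>R wgrad p z + t *\<^sub>R wgrad q z) \<in> L2"
    by (intro L2_lin wgrad assms)
  moreover have "has_weak_gradient (\<lambda>z. s * p z + t * q z) (\<lambda>z. s *\<^sub>R wgrad p z + t *\<^sub>R wgrad q z)"
    by (intro has_weak_gradient_lin wgrad H1_imp_L2 assms)
  ultimately show "(\<lambda>z. s * p z + t * q z) \<in> H1"
    and "AE z in M. wgrad (\<lambda>z. s * p z + t * q z) z = s *\<^sub>R wgrad p z + t *\<^sub>R wgrad q z"
    by (rule H1I, rule wgrad_eqI)
qed

lemma H1_diff:
  assumes "p \<in> H1" "q \<in> H1"
  shows "(\<lambda>z. p z - q z) \<in> H1" "AE z in M. wgrad (\<lambda>z. p z - q z) z = wgrad p z - wgrad q z"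
  using H1_lin[OF assms, of 1 "-1"] by simp_all

definition grad :: "(real \<times> real \<Rightarrow> real) \<Rightarrow> real \<times> real \<Rightarrow> real \<times> real" where
  "grad \<phi> z = (\<Sum>i\<in>Basis. pd i \<phi> z *\<^sub>R i)"

lemma grad_inner: "i \<in> Basis \<Longrightarrow> grad \<phi> z \<bullet> i = pd i \<phi> z"
  unfolding grad_def by (rule inner_sum_left_Basis)

lemma grad_inner_grad: "grad \<phi> z \<bullet> grad \<phi> z = (\<Sum>i\<in>Basis. pd i \<phi> z * pd i \<phi> z)"
  by (subst euclidean_inner) (simp add: grad_inner)

lemma test_function_H1:
  assumes \<phi>: "\<phi> \<in> test_functions"
  shows "\<phi> \<in> H1" "grad \<phi> \<in> L2" "AE z in M. wgrad \<phi> z = grad \<phi> z"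
proof -
  have "integrable M (\<lambda>z. (norm (grad \<phi> z))\<^sup>2)"
    unfolding power2_norm_eq_inner grad_inner_grad
    by (intro Bochner_Integration.integrable_sum L2_mult_integrable test_function_L2(2)[OF \<phi>])
  moreover have "grad \<phi> \<in> borel_measurable M"
    unfolding grad_def
    by (intro borel_measurable_sum borel_measurable_scaleR borel_measurable_const L2_measurable
        test_function_L2(2)[OF \<phi>])
  ultimately show grad: "grad \<phi> \<in> L2" by (simp add: L2_def)
  have "has_weak_gradient \<phi> (grad \<phi>)"
    unfolding has_weak_gradient_def
  proof (intro ballI)
    fix \<psi> and i :: "real \<times> real" assume \<psi>: "\<psi> \<in> test_functions" and i: "i \<in> Basis"
    have "integrable M (\<lambda>z. \<phi> z * pd i \<psi> z)" "integrable M (\<lambda>z. pd i \<phi> z * \<psi> z)"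
      by (intro L2_mult_integrable test_function_L2 \<phi> \<psi> i)+
    then show "(LINT z|M. \<phi> z * pd i \<psi> z) = - (LINT z|M. (grad \<phi> z \<bullet> i) * \<psi> z)"
      using integration_by_parts[OF \<psi> test_functionsD(1)[OF \<phi>] i] by (simp add: grad_inner i)
  qed
  with test_function_L2(1)[OF \<phi>] grad
  show "\<phi> \<in> H1" "AE z in M. wgrad \<phi> z = grad \<phi> z"
    by (rule H1I, rule wgrad_eqI)
qed


section \<open>The space \<open>V\<close>\<close>

lemma ip2_cong_AE:
  fixes g g' h h' :: "real \<times> real \<Rightarrow> 'b::euclidean_space"
  assumes "g \<in> L2" "g' \<in> L2" "h \<in> L2" "h' \<in> L2"
    and "AE z in M. g z = g' z" "AE z in M. h z = h' z"
  shows "ip2 g h = ip2 g' h'"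
proof (rule integral_cong_AE)
  have [measurable]: "g \<in> borel_measurable M" "g' \<in> borel_measurable M"
    "h \<in> borel_measurable M" "h' \<in> borel_measurable M"
    using assms by (auto intro: L2_measurable)
  show "(\<lambda>z. g z \<bullet> h z) \<in> borel_measurable M" "(\<lambda>z. g' z \<bullet> h' z) \<in> borel_measurable M"
    by measurable
  show "AE z in M. g z \<bullet> h z = g' z \<bullet> h' z" using assms(5,6) by eventually_elim simp
qed

abbreviation ipV :: "(real \<times> real \<Rightarrow> real) \<Rightarrow> (real \<times> real \<Rightarrow> real) \<Rightarrow> real" where
  "ipV p q \<equiv> ip2 (wgrad p) (wgrad q)"

definition ipH1 :: "(real \<times> real \<Rightarrow> real) \<Rightarrow> (real \<times> real \<Rightarrow> real) \<Rightarrow> real" where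
  "ipH1 p q = ip2 p q + ipV p q"

lemma wgrad_lin_ip2:
  assumes "p \<in> H1" "q \<in> H1" "h \<in> L2"
  shows "ip2 (wgrad (\<lambda>z. s * p z + t * q z)) h = s * ip2 (wgrad p) h + t * ip2 (wgrad q) h"
proof -
  have "ip2 (wgrad (\<lambda>z. s * p z + t * q z)) h = ip2 (\<lambda>z. s *\<^sub>R wgrad p z + t *\<^sub>R wgrad q z) h"
    by (rule ip2_cong_AE) (use assms in \<open>auto intro: wgrad H1_lin L2_lin\<close>)
  then show ?thesis using L2.lin[OF wgrad(1)[OF assms(1)] wgrad(1)[OF assms(2)] assms(3)] by simp
qed

interpretation gradient: semi_inner_space H1 ipV
proof
  show "ipV p q = ipV q p" for p q by (simp add: inner_commute)
qed (auto simp: H1_lin wgrad_lin_ip2 wgrad)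

interpretation H1: semi_inner_space H1 ipH1
proof
  fix p q r :: "real \<times> real \<Rightarrow> real" and s t :: real
  assume p: "p \<in> H1" and q: "q \<in> H1"
  show "(\<lambda>z. s *\<^sub>R p z + t *\<^sub>R q z) \<in> H1" using p q by (rule gradient.lin_closed)
  show "ipH1 p q = ipH1 q p" by (simp add: ipH1_def inner_commute mult.commute)
  show "0 \<le> ipH1 p p" by (simp add: ipH1_def)
  assume r: "r \<in> H1"
  show "ipH1 (\<lambda>z. s *\<^sub>R p z + t *\<^sub>R q z) r = s * ipH1 p r + t * ipH1 q r"
    unfolding ipH1_def gradient.lin[OF p q r] L2.lin[OF p[THEN H1_imp_L2] q[THEN H1_imp_L2] r[THEN H1_imp_L2]]
    by (simp add: algebra_simps)
qed

lemma H1_norm_eq: "H1_norm p = sqrt (ipH1 p p)"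
  unfolding H1_norm_def ipH1_def ip2_square by simp

lemma V_norm_eq: "V_norm p = sqrt (ipV p p)"
  by (simp add: V_norm_def ip2_square)

lemma V_iff: "p \<in> V \<longleftrightarrow> p \<in> H1 \<and>
    (\<exists>\<phi>. (\<forall>k. \<phi> k \<in> test_functions) \<and> (\<lambda>k::nat. ipH1 (\<lambda>z. p z - \<phi> k z) (\<lambda>z. p z - \<phi> k z)) \<longlonglongrightarrow> 0)"
proof -
  have "(\<lambda>k. sqrt (h k)) \<longlonglongrightarrow> 0 \<longleftrightarrow> h \<longlonglongrightarrow> 0" for h :: "nat \<Rightarrow> real"
  proof
    assume lim: "(\<lambda>k. sqrt (h k)) \<longlonglongrightarrow> 0"
    show "h \<longlonglongrightarrow> 0"
      using tendsto_mult[OF lim lim] by (simp add: tendsto_rabs_zero_iff)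
  next
    assume "h \<longlonglongrightarrow> 0"
    from tendsto_real_sqrt[OF this] show "(\<lambda>k. sqrt (h k)) \<longlonglongrightarrow> 0" by simp
  qed
  then show ?thesis unfolding V_def H1_norm_eq by simp
qed

lemma V_imp_H1: "p \<in> V \<Longrightarrow> p \<in> H1"
  by (simp add: V_def)

lemma test_function_V: "\<phi> \<in> test_functions \<Longrightarrow> \<phi> \<in> V"
  unfolding V_iff
  using H1.quadratic[of \<phi> \<phi> 1 "-1"] test_function_H1(1)[of \<phi>]
  by (intro conjI exI[of _ "\<lambda>k. \<phi>"]) auto

lemma V_lin:
  assumes "p \<in> V" "q \<in> V"
  shows "(\<lambda>z. s * p z + t * q z) \<in> V"
proof -
  obtain \<phi> where \<phi>: "\<And>k. \<phi> k \<in> test_functions" "(\<lambda>k::nat. ipH1 (\<lambda>z. p z - \<phi> k z) (\<lambda>z. p z - \<phi> k z)) \<longlonglongrightarrow> 0"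
    using assms(1) unfolding V_iff by blast
  obtain \<psi> where \<psi>: "\<And>k. \<psi> k \<in> test_functions" "(\<lambda>k::nat. ipH1 (\<lambda>z. q z - \<psi> k z) (\<lambda>z. q z - \<psi> k z)) \<longlonglongrightarrow> 0"
    using assms(2) unfolding V_iff by blast
  define \<omega> where "\<omega> k z = s * \<phi> k z + t * \<psi> k z" for k z
  have \<omega>: "\<omega> k \<in> test_functions" for k
    unfolding \<omega>_def by (intro test_functions_lin \<phi> \<psi>)
  define r where "r z = s * p z + t * q z" for z
  have pH: "p \<in> H1" "q \<in> H1" using assms by (auto intro: V_imp_H1)
  then have "r \<in> H1" unfolding r_def by (rule H1_lin)
  moreover have "(\<lambda>k. ipH1 (\<lambda>z. r z - \<omega> k z) (\<lambda>z. r z - \<omega> k z)) \<longlonglongrightarrow> 0"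
  proof (rule tendsto_sandwich[of "\<lambda>_. 0"])
    let ?b = "\<lambda>k. 2 * s\<^sup>2 * ipH1 (\<lambda>z. p z - \<phi> k z) (\<lambda>z. p z - \<phi> k z)
      + 2 * t\<^sup>2 * ipH1 (\<lambda>z. q z - \<psi> k z) (\<lambda>z. q z - \<psi> k z)"
    have "ipH1 (\<lambda>z. r z - \<omega> k z) (\<lambda>z. r z - \<omega> k z) \<le> ?b k" for k
    proof -
      have "(\<lambda>z. r z - \<omega> k z) = (\<lambda>z. s *\<^sub>R (p z - \<phi> k z) + t *\<^sub>R (q z - \<psi> k z))"
        by (simp add: r_def \<omega>_def algebra_simps fun_eq_iff)
      then show ?thesis
        using H1.square_lin_le[OF H1.diff_closed[OF pH(1) test_function_H1(1)[OF \<phi>(1)]]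
            H1.diff_closed[OF pH(2) test_function_H1(1)[OF \<psi>(1)]], of s k t k] by simp
    qed
    then show "\<forall>\<^sub>F k in sequentially. ipH1 (\<lambda>z. r z - \<omega> k z) (\<lambda>z. r z - \<omega> k z) \<le> ?b k" by simp
    have "?b \<longlonglongrightarrow> 2 * s\<^sup>2 * 0 + 2 * t\<^sup>2 * 0"
      by (intro tendsto_intros \<phi> \<psi>)
    then show "?b \<longlonglongrightarrow> 0" by simp
    show "\<forall>\<^sub>F k in sequentially. 0 \<le> ipH1 (\<lambda>z. r z - \<omega> k z) (\<lambda>z. r z - \<omega> k z)"
      using H1.nonneg[OF H1.diff_closed[OF \<open>r \<in> H1\<close> test_function_H1(1)[OF \<omega>]]] by simp
  qed simp
  ultimately show ?thesis
    unfolding r_def[symmetric] V_iff using \<omega> by blast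
qed

lemma V_diff: "p \<in> V \<Longrightarrow> q \<in> V \<Longrightarrow> (\<lambda>z. p z - q z) \<in> V"
  using V_lin[of p q 1 "-1"] by simp

text \<open>
  Integrating \<open>x * \<partial>\<^sub>x (\<phi>\<^sup>2)\<close> by parts gives \<open>\<integral> \<phi>\<^sup>2 = - 2 \<integral> x \<phi> \<partial>\<^sub>x\<phi>\<close>, and the right-hand side is at most
  \<open>\<integral> \<phi>\<^sup>2 / 2 + 2 \<integral> (\<partial>\<^sub>x\<phi>)\<^sup>2\<close> because \<open>0 < x < 1\<close>.
\<close>

lemma Poincare_test_function:
  assumes \<phi>: "\<phi> \<in> test_functions"
  shows "ip2 \<phi> \<phi> \<le> 4 * ipV \<phi> \<phi>"
proof -
  define e :: "real \<times> real" where "e = (1, 0)"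
  have e: "e \<in> Basis" by (simp add: e_def Basis_prod_def)
  have [measurable]: "(\<lambda>z. z \<bullet> e) \<in> borel_measurable M"
    by (intro borel_measurable_M) measurable
  have x: "0 \<le> z \<bullet> e" "z \<bullet> e \<le> 1" if "z \<in> D" for z
    using that by (auto simp: e_def D_def)
  let ?\<psi> = "\<lambda>z. (z \<bullet> e) * \<phi> z"
  have Ck: "Ck k ?\<psi>" for k
    by (intro Ck_mult Ck_coordinate test_functionsD \<phi>)
  have pd\<psi>: "pd e ?\<psi> z = (z \<bullet> e) * pd e \<phi> z + \<phi> z" for z
  proof -
    have "(\<lambda>z. z \<bullet> e) differentiable (at z)"
      by (rule Ck_Suc_imp_differentiable[OF Ck_coordinate])
    moreover have "pd e (\<lambda>z. z \<bullet> e) z = 1"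
    proof -
      have "((\<lambda>z. z \<bullet> e) has_derivative (\<lambda>h. h \<bullet> e)) (at z)"
        by (auto intro!: derivative_eq_intros)
      from frechet_derivative_at[OF this] have "pd e (\<lambda>z. z \<bullet> e) z = e \<bullet> e" by metis
      then show ?thesis by (simp add: e_def)
    qed
    ultimately show ?thesis
      using pd_mult[of "\<lambda>z. z \<bullet> e" z \<phi> e] test_functionsD(2)[OF \<phi>] by simp
  qed
  have xpd: "(\<lambda>z. (z \<bullet> e) *\<^sub>R pd e \<phi> z) \<in> L2"
    using x by (intro L2_mult_bounded[where C = 1] test_function_L2 \<phi> e) (auto intro!: AE_I2)
  have int: "integrable M (\<lambda>z. \<phi> z * \<phi> z)" "integrable M (\<lambda>z. \<phi> z * ((z \<bullet> e) * pd e \<phi> z))"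
    "integrable M (\<lambda>z. pd e \<phi> z * pd e \<phi> z)"
    using xpd[simplified]
    by (simp_all only: L2_mult_integrable test_function_L2(1)[OF \<phi>] test_function_L2(2)[OF \<phi> e])
  have "0 = (LINT z|M. 2 * (\<phi> z * ((z \<bullet> e) * pd e \<phi> z)) + \<phi> z * \<phi> z)"
    using integration_by_parts[OF \<phi> Ck e, unfolded pd\<psi>] by (simp add: algebra_simps)
  also have "\<dots> \<ge> (LINT z|M. \<phi> z * \<phi> z / 2 - 2 * (pd e \<phi> z * pd e \<phi> z))"
  proof (rule integral_mono)
    fix z assume "z \<in> space M"
    then have "z \<in> D" by simp
    have "0 \<le> (\<phi> z + 2 * ((z \<bullet> e) * pd e \<phi> z))\<^sup>2" by simp
    then have "- (\<phi> z * \<phi> z / 2 + 2 * ((z \<bullet> e) * pd e \<phi> z)\<^sup>2) \<le> 2 * (\<phi> z * ((z \<bullet> e) * pd e \<phi> z))"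
      by (simp add: power2_eq_square algebra_simps)
    moreover have "((z \<bullet> e) * pd e \<phi> z)\<^sup>2 \<le> (pd e \<phi> z)\<^sup>2"
      using x[OF \<open>z \<in> D\<close>] by (simp add: power_mult_distrib power_le_one mult_left_le_one_le)
    ultimately show "\<phi> z * \<phi> z / 2 - 2 * (pd e \<phi> z * pd e \<phi> z)
        \<le> 2 * (\<phi> z * ((z \<bullet> e) * pd e \<phi> z)) + \<phi> z * \<phi> z"
      by (simp add: power2_eq_square)
  qed (use int in auto)
  finally have "(LINT z|M. \<phi> z * \<phi> z) \<le> 4 * (LINT z|M. pd e \<phi> z * pd e \<phi> z)"
    using int by simp
  also have "(LINT z|M. pd e \<phi> z * pd e \<phi> z) \<le> ip2 (grad \<phi>) (grad \<phi>)"
  proof (rule integral_mono[OF int(3) L2_inner_integrable])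
    show "pd e \<phi> z * pd e \<phi> z \<le> grad \<phi> z \<bullet> grad \<phi> z" for z
      unfolding grad_inner_grad
      using member_le_sum[of e Basis "\<lambda>i. pd i \<phi> z * pd i \<phi> z"] e by simp
  qed (rule test_function_H1[OF \<phi>])+
  also have "ip2 (grad \<phi>) (grad \<phi>) = ipV \<phi> \<phi>"
    using test_function_H1[OF \<phi>] wgrad(1)
    by (intro ip2_cong_AE) (auto elim: eventually_mono)
  finally show ?thesis by simp
qed

text \<open>
  Both sides are continuous in the \<open>H1\<close> norm, in which test functions approximate \<open>p\<close>; the larger constant
  comes from splitting squares of sums crudely.
\<close>

lemma Poincare:
  assumes p: "p \<in> V"
  shows "ip2 p p \<le> 16 * ipV p p"
proof -
  obtain \<phi> where \<phi>: "\<And>k. \<phi> k \<in> test_functions"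
    and lim: "(\<lambda>k::nat. ipH1 (\<lambda>z. p z - \<phi> k z) (\<lambda>z. p z - \<phi> k z)) \<longlonglongrightarrow> 0"
    using p unfolding V_iff by blast
  have pH: "p \<in> H1" using p by (rule V_imp_H1)
  let ?e = "\<lambda>k. ipH1 (\<lambda>z. p z - \<phi> k z) (\<lambda>z. p z - \<phi> k z)"
  have "ip2 p p \<le> 18 * ?e k + 16 * ipV p p" for k
  proof -
    have arith: "a \<le> 18 * (b + w) + 16 * u"
      if "a \<le> 2 * b + 2 * c" "v \<le> 2 * w + 2 * u" "0 \<le> w" "0 \<le> b" "c \<le> 4 * v"
      for a b c u v w :: real using that by argo
    note \<phi>H = test_function_H1(1)[OF \<phi>[of k]]
    have "ip2 p p \<le> 2 * ip2 (\<lambda>z. p z - \<phi> k z) (\<lambda>z. p z - \<phi> k z) + 2 * ip2 (\<phi> k) (\<phi> k)"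
      using L2.square_add_le[OF L2.diff_closed[OF H1_imp_L2[OF pH] H1_imp_L2[OF \<phi>H]] H1_imp_L2[OF \<phi>H]] by simp
    moreover have "ipV (\<phi> k) (\<phi> k) \<le> 2 * ipV (\<lambda>z. p z - \<phi> k z) (\<lambda>z. p z - \<phi> k z) + 2 * ipV p p"
      using gradient.square_add_le[OF gradient.diff_closed[OF \<phi>H pH] pH]
      by (simp add: gradient.square_diff_commute[OF pH \<phi>H])
    moreover have "0 \<le> ipV (\<lambda>z. p z - \<phi> k z) (\<lambda>z. p z - \<phi> k z)"
      "0 \<le> ip2 (\<lambda>z. p z - \<phi> k z) (\<lambda>z. p z - \<phi> k z)" by simp_all
    ultimately show ?thesis
      using Poincare_test_function[OF \<phi>[of k]] unfolding ipH1_def by (rule arith)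
  qed
  moreover have "(\<lambda>k. 18 * ?e k + 16 * ipV p p) \<longlonglongrightarrow> 18 * 0 + 16 * ipV p p"
    by (intro tendsto_intros lim)
  ultimately have "ip2 p p \<le> 18 * 0 + 16 * ipV p p"
    by (intro LIMSEQ_le_const) auto
  then show ?thesis by simp
qed

text \<open>
  By the Poincare inequality the functions converge in \<open>L\<^sup>2\<close> along with their gradients, and the
  weak gradient is closed, so the limit lies in \<open>H1\<close>. It is approximated by test functions
  because each member of the sequence is, with an error chosen to tend to zero.
\<close>

theorem V_complete:
  assumes P: "\<And>k::nat. P k \<in> V"
    and cauchy: "\<And>e. e > 0 \<Longrightarrow>
      \<exists>N. \<forall>i\<ge>N. \<forall>j\<ge>N. ipV (\<lambda>z. P i z - P j z) (\<lambda>z. P i z - P j z) < e"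
  shows "\<exists>p\<in>V. (\<lambda>k. ipV (\<lambda>z. P k z - p z) (\<lambda>z. P k z - p z)) \<longlonglongrightarrow> 0"
proof -
  have PH: "P k \<in> H1" for k using P by (rule V_imp_H1)
  have ipV_diff: "ipV (\<lambda>z. q z - r z) (\<lambda>z. q z - r z)
      = ip2 (\<lambda>z. wgrad q z - wgrad r z) (\<lambda>z. wgrad q z - wgrad r z)"
    if "q \<in> H1" "r \<in> H1" for q r
    using that by (intro ip2_cong_AE wgrad H1_diff L2.diff_closed)
  have "\<exists>p\<in>L2. (\<lambda>k. ip2 (\<lambda>z. P k z - p z) (\<lambda>z. P k z - p z)) \<longlonglongrightarrow> 0"
  proof (rule L2_complete)
    show "P k \<in> L2" for k using PH by (rule H1_imp_L2)
    fix e :: real assume "e > 0"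
    then obtain N where N: "\<And>i j. i \<ge> N \<Longrightarrow> j \<ge> N \<Longrightarrow> ipV (\<lambda>z. P i z - P j z) (\<lambda>z. P i z - P j z) < e / 16"
      using cauchy[of "e / 16"] by auto
    have "ip2 (\<lambda>z. P i z - P j z) (\<lambda>z. P i z - P j z) < e" if "i \<ge> N" "j \<ge> N" for i j
      using Poincare[OF V_diff[OF P P], of i j] N[OF that] by simp
    then show "\<exists>N. \<forall>i\<ge>N. \<forall>j\<ge>N. ip2 (\<lambda>z. P i z - P j z) (\<lambda>z. P i z - P j z) < e" by blast
  qed
  then obtain p where p: "p \<in> L2" and limp: "(\<lambda>k. ip2 (\<lambda>z. P k z - p z) (\<lambda>z. P k z - p z)) \<longlonglongrightarrow> 0"
    by blast
  have "\<exists>g\<in>L2. (\<lambda>k. ip2 (\<lambda>z. wgrad (P k) z - g z) (\<lambda>z. wgrad (P k) z - g z)) \<longlonglongrightarrow> 0"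
    using wgrad(1)[OF PH] cauchy unfolding ipV_diff[OF PH PH] by (rule L2_complete)
  then obtain g where g: "g \<in> L2"
    and limg: "(\<lambda>k. ip2 (\<lambda>z. wgrad (P k) z - g z) (\<lambda>z. wgrad (P k) z - g z)) \<longlonglongrightarrow> 0"
    by blast
  have wg: "has_weak_gradient p g"
    using H1_imp_L2[OF PH] p wgrad(1)[OF PH] g wgrad(2)[OF PH] limp limg
    by (rule has_weak_gradient_limit)
  have pH: "p \<in> H1" using p g wg by (rule H1I)
  have "ip2 (\<lambda>z. wgrad (P k) z - g z) (\<lambda>z. wgrad (P k) z - g z) = ipV (\<lambda>z. P k z - p z) (\<lambda>z. P k z - p z)" for k
    unfolding ipV_diff[OF PH pH] using wgrad_eqI[OF p g wg]
    by (intro ip2_cong_AE L2.diff_closed wgrad PH pH g) (auto elim: eventually_mono)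
  with limg have limV: "(\<lambda>k. ipV (\<lambda>z. P k z - p z) (\<lambda>z. P k z - p z)) \<longlonglongrightarrow> 0" by simp
  with limp have limH: "(\<lambda>k. ipH1 (\<lambda>z. P k z - p z) (\<lambda>z. P k z - p z)) \<longlonglongrightarrow> 0"
    unfolding ipH1_def using tendsto_add by fastforce
  have "\<exists>\<phi>\<in>test_functions. ipH1 (\<lambda>z. P k z - \<phi> z) (\<lambda>z. P k z - \<phi> z) < 1 / real (Suc k)" for k
  proof -
    obtain \<phi> where \<phi>: "\<And>j. \<phi> j \<in> test_functions"
      "(\<lambda>j::nat. ipH1 (\<lambda>z. P k z - \<phi> j z) (\<lambda>z. P k z - \<phi> j z)) \<longlonglongrightarrow> 0"
      using P[of k] unfolding V_iff by blast
    from order_tendstoD(2)[OF \<phi>(2), of "1 / real (Suc k)"]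
    obtain j where "ipH1 (\<lambda>z. P k z - \<phi> j z) (\<lambda>z. P k z - \<phi> j z) < 1 / real (Suc k)"
      by (auto simp: eventually_sequentially)
    then show ?thesis using \<phi>(1) by blast
  qed
  then obtain \<phi> where \<phi>: "\<And>k. \<phi> k \<in> test_functions"
    "\<And>k. ipH1 (\<lambda>z. P k z - \<phi> k z) (\<lambda>z. P k z - \<phi> k z) < 1 / real (Suc k)"
    by metis
  have "(\<lambda>k. ipH1 (\<lambda>z. p z - \<phi> k z) (\<lambda>z. p z - \<phi> k z)) \<longlonglongrightarrow> 0"
  proof (rule tendsto_sandwich[of "\<lambda>_. 0"])
    let ?b = "\<lambda>k. 2 * ipH1 (\<lambda>z. P k z - p z) (\<lambda>z. P k z - p z) + 2 * (1 / real (Suc k))"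
    have "ipH1 (\<lambda>z. p z - \<phi> k z) (\<lambda>z. p z - \<phi> k z) \<le> ?b k" for k
    proof -
      note \<phi>H = test_function_H1(1)[OF \<phi>(1)[of k]]
      have "ipH1 (\<lambda>z. p z - \<phi> k z) (\<lambda>z. p z - \<phi> k z)
          \<le> 2 * ipH1 (\<lambda>z. p z - P k z) (\<lambda>z. p z - P k z) + 2 * ipH1 (\<lambda>z. P k z - \<phi> k z) (\<lambda>z. P k z - \<phi> k z)"
        using H1.square_add_le[OF H1.diff_closed[OF pH PH[of k]] H1.diff_closed[OF PH[of k] \<phi>H]] by simp
      then show ?thesis
        using \<phi>(2)[of k] H1.square_diff_commute[OF pH PH[of k]] by linarith
    qed
    then show "\<forall>\<^sub>F k in sequentially. ipH1 (\<lambda>z. p z - \<phi> k z) (\<lambda>z. p z - \<phi> k z) \<le> ?b k" by simp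
    have "?b \<longlonglongrightarrow> 2 * 0 + 2 * 0"
      using LIMSEQ_inverse_real_of_nat by (intro tendsto_intros limH) (simp add: inverse_eq_divide)
    then show "?b \<longlonglongrightarrow> 0" by simp
    show "\<forall>\<^sub>F k in sequentially. 0 \<le> ipH1 (\<lambda>z. p z - \<phi> k z) (\<lambda>z. p z - \<phi> k z)"
      using H1.nonneg[OF H1.diff_closed[OF pH test_function_H1(1)[OF \<phi>(1)]]] by simp
  qed simp
  then have "p \<in> V" unfolding V_iff using pH \<phi>(1) by blast
  with limV show ?thesis by blast
qed


section \<open>Existence and stability of weak solutions\<close>

lemma XI:
  assumes \<kappa>: "\<kappa> \<in> borel_measurable M" and "0 < lo" and bd: "AE z in M. lo \<le> \<kappa> z \<and> \<kappa> z \<le> hi"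
  shows "\<kappa> \<in> X"
proof -
  note [measurable] = \<kappa>
  have "esssup M (\<lambda>z. ereal \<bar>\<kappa> z\<bar>) \<le> ereal hi"
  proof (rule esssup_I)
    show "AE z in M. ereal \<bar>\<kappa> z\<bar> \<le> ereal hi"
      using bd by eventually_elim (use \<open>0 < lo\<close> in auto)
  qed measurable
  then have "esssup M (\<lambda>z. ereal \<bar>\<kappa> z\<bar>) < \<infinity>" by (rule le_less_trans) simp
  moreover have "esssup M (\<lambda>z. - ereal (\<kappa> z)) \<le> ereal (- lo)"
  proof (rule esssup_I)
    show "AE z in M. - ereal (\<kappa> z) \<le> ereal (- lo)"
      using bd by eventually_elim auto
  qed measurable
  then have "essinf \<kappa> \<ge> ereal lo"
    unfolding essinf_def by (metis ereal_minus_le_minus ereal_uminus_uminus uminus_ereal.simps(1))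
  then have "essinf \<kappa> > 0" using \<open>0 < lo\<close> by (metis ereal_less(2) less_le_trans)
  ultimately show ?thesis unfolding X_def Linfty_def using \<kappa> by simp
qed

text \<open>Existence is the Riesz representation of \<open>f\<close> for the energy form of \<open>\<kappa>\<close>, whose norm is equivalent
  to that of \<open>V\<close>.\<close>

theorem weak_solution_exists:
  assumes f: "f \<in> V_dual" and \<kappa>: "\<kappa> \<in> borel_measurable M"
    and "0 < lo" and bd: "AE z in M. lo \<le> \<kappa> z \<and> \<kappa> z \<le> hi"
  shows "weak_solution f \<kappa> (G f \<kappa>)"
proof -
  have bd': "AE z in M. \<bar>\<kappa> z\<bar> \<le> hi"
    using bd by eventually_elim (use \<open>0 < lo\<close> in auto)
  define E where "E p q = (LINT z|M. \<kappa> z * (wgrad p z \<bullet> wgrad q z))" for p q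
  have E_ip2: "E p q = ip2 (\<lambda>z. \<kappa> z *\<^sub>R wgrad p z) (wgrad q)" for p q by (simp add: E_def)
  have w: "wgrad p \<in> L2" if "p \<in> V" for p
    using that by (intro wgrad V_imp_H1)
  have \<kappa>w: "(\<lambda>z. \<kappa> z *\<^sub>R wgrad p z) \<in> L2" if "p \<in> V" for p
    by (rule L2_mult_bounded[OF w[OF that] \<kappa> bd'])
  have int: "integrable M (\<lambda>z. \<kappa> z * (wgrad p z \<bullet> wgrad p z))" if "p \<in> V" for p
    using L2_inner_integrable[OF \<kappa>w w] that by simp
  have lower: "lo * ipV p p \<le> E p p" if "p \<in> V" for p
  proof -
    have "(LINT z|M. lo * (wgrad p z \<bullet> wgrad p z)) \<le> E p p"
      unfolding E_def
    proof (rule integral_mono_AE[OF integrable_mult_right[OF L2_inner_integrable[OF w w]] int])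
      show "AE z in M. lo * (wgrad p z \<bullet> wgrad p z) \<le> \<kappa> z * (wgrad p z \<bullet> wgrad p z)"
        using bd by eventually_elim (simp add: mult_right_mono)
    qed (use that in auto)
    then show ?thesis by simp
  qed
  have upper: "E p p \<le> hi * ipV p p" if "p \<in> V" for p
  proof -
    have "E p p \<le> (LINT z|M. hi * (wgrad p z \<bullet> wgrad p z))"
      unfolding E_def
    proof (rule integral_mono_AE[OF int integrable_mult_right[OF L2_inner_integrable[OF w w]]])
      show "AE z in M. \<kappa> z * (wgrad p z \<bullet> wgrad p z) \<le> hi * (wgrad p z \<bullet> wgrad p z)"
        using bd by eventually_elim (simp add: mult_right_mono)
    qed (use that in auto)
    then show ?thesis by simp
  qed
  interpret energy: semi_inner_space V E
  proof
    fix p q r :: "real \<times> real \<Rightarrow> real" and s t :: real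
    assume p: "p \<in> V" and q: "q \<in> V"
    show "(\<lambda>z. s *\<^sub>R p z + t *\<^sub>R q z) \<in> V" using V_lin[OF p q] by simp
    show sym: "E p q = E q p" for p q unfolding E_def by (simp only: inner_commute)
    have "0 \<le> lo * ipV p p" using \<open>0 < lo\<close> by simp
    then show "0 \<le> E p p" using lower[OF p] by (rule order_trans)
    assume r: "r \<in> V"
    have "E (\<lambda>z. s *\<^sub>R p z + t *\<^sub>R q z) r = E r (\<lambda>z. s *\<^sub>R p z + t *\<^sub>R q z)" by (rule sym)
    also have "\<dots> = ip2 (wgrad (\<lambda>z. s * p z + t * q z)) (\<lambda>z. \<kappa> z *\<^sub>R wgrad r z)"
      unfolding E_ip2 by (simp add: inner_commute)
    also have "\<dots> = s * ip2 (wgrad p) (\<lambda>z. \<kappa> z *\<^sub>R wgrad r z) + t * ip2 (wgrad q) (\<lambda>z. \<kappa> z *\<^sub>R wgrad r z)"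
      by (intro wgrad_lin_ip2 V_imp_H1 p q \<kappa>w r)
    also have "\<dots> = s * E p r + t * E q r" by (simp add: E_def)
    finally show "E (\<lambda>z. s *\<^sub>R p z + t *\<^sub>R q z) r = s * E p r + t * E q r" .
  qed
  obtain C where C: "\<And>p. p \<in> V \<Longrightarrow> \<bar>f p\<bar> \<le> C * V_norm p" using f unfolding V_dual_def by blast
  have "\<exists>p\<in>V. \<forall>v\<in>V. E p v = f v"
  proof (rule energy.Riesz_representation)
    show "V \<noteq> {}" using test_function_V[OF test_functions_zero] by blast
    show "f (\<lambda>z. s *\<^sub>R p z + t *\<^sub>R q z) = s * f p + t * f q" if "p \<in> V" "q \<in> V" for p q s t
      using f that unfolding V_dual_def by simp
    show "\<bar>f p\<bar> \<le> (\<bar>C\<bar> / sqrt lo) * sqrt (E p p)" if p: "p \<in> V" for p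
    proof -
      have "\<bar>f p\<bar> \<le> \<bar>C\<bar> * V_norm p"
        using C[OF p] by (rule order_trans) (simp add: V_norm_eq mult_right_mono)
      moreover have "sqrt lo * V_norm p \<le> sqrt (E p p)"
        using real_sqrt_le_mono[OF lower[OF p]] by (simp add: V_norm_eq real_sqrt_mult)
      then have "V_norm p \<le> sqrt (E p p) / sqrt lo"
        using \<open>0 < lo\<close> by (simp add: field_simps)
      then have "\<bar>C\<bar> * V_norm p \<le> \<bar>C\<bar> * (sqrt (E p p) / sqrt lo)"
        by (rule mult_left_mono) simp
      ultimately show ?thesis by simp
    qed
    fix P :: "nat \<Rightarrow> real \<times> real \<Rightarrow> real"
    assume P: "\<And>k. P k \<in> V"
      and cauchy: "\<And>e. e > 0 \<Longrightarrow> \<exists>N. \<forall>i\<ge>N. \<forall>j\<ge>N. E (\<lambda>z. P i z - P j z) (\<lambda>z. P i z - P j z) < e"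
    have "\<exists>p\<in>V. (\<lambda>k. ipV (\<lambda>z. P k z - p z) (\<lambda>z. P k z - p z)) \<longlonglongrightarrow> 0"
    proof (rule V_complete[OF P])
      fix e :: real assume "e > 0"
      then obtain N where N: "\<And>i j. i \<ge> N \<Longrightarrow> j \<ge> N \<Longrightarrow> E (\<lambda>z. P i z - P j z) (\<lambda>z. P i z - P j z) < lo * e"
        using cauchy[of "lo * e"] \<open>0 < lo\<close> by auto
      have "ipV (\<lambda>z. P i z - P j z) (\<lambda>z. P i z - P j z) < e" if "i \<ge> N" "j \<ge> N" for i j
        using le_less_trans[OF lower[OF V_diff[OF P P]] N[OF that]] \<open>0 < lo\<close> by simp
      then show "\<exists>N. \<forall>i\<ge>N. \<forall>j\<ge>N. ipV (\<lambda>z. P i z - P j z) (\<lambda>z. P i z - P j z) < e" by blast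
    qed
    then obtain p where p: "p \<in> V" and lim: "(\<lambda>k. ipV (\<lambda>z. P k z - p z) (\<lambda>z. P k z - p z)) \<longlonglongrightarrow> 0"
      by blast
    have "(\<lambda>k. E (\<lambda>z. P k z - p z) (\<lambda>z. P k z - p z)) \<longlonglongrightarrow> 0"
    proof (rule tendsto_sandwich[of "\<lambda>_. 0"])
      show "\<forall>\<^sub>F k in sequentially. E (\<lambda>z. P k z - p z) (\<lambda>z. P k z - p z)
          \<le> hi * ipV (\<lambda>z. P k z - p z) (\<lambda>z. P k z - p z)"
        by (intro always_eventually allI upper V_diff P p)
      show "\<forall>\<^sub>F k in sequentially. 0 \<le> E (\<lambda>z. P k z - p z) (\<lambda>z. P k z - p z)"
        by (intro always_eventually allI energy.nonneg V_diff P p)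
      show "(\<lambda>k. hi * ipV (\<lambda>z. P k z - p z) (\<lambda>z. P k z - p z)) \<longlonglongrightarrow> 0"
        using tendsto_mult_left[OF lim, of hi] by simp
    qed simp
    then show "\<exists>p\<in>V. (\<lambda>k. E (\<lambda>z. P k z - p z) (\<lambda>z. P k z - p z)) \<longlonglongrightarrow> 0"
      using p by blast
  qed
  then have "\<exists>p. weak_solution f \<kappa> p"
    unfolding weak_solution_def E_def using XI[OF \<kappa> \<open>0 < lo\<close> bd] by blast
  then show ?thesis unfolding G_def by (rule someI_ex)
qed

text \<open>
  Testing both equations with \<open>w = q - p\<close> gives \<open>\<integral> \<kappa>' \<bar>\<nabla>w\<bar>\<^sup>2 = \<integral> (\<kappa> - \<kappa>') \<nabla>p \<bullet> \<nabla>w\<close>. The coefficient difference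
  is paired with \<open>\<nabla>p\<close> in \<open>L\<^sup>2\<close>, so that it need not be small uniformly.
\<close>

lemma weak_solution_stability:
  assumes p: "weak_solution f \<kappa> p" and q: "weak_solution f \<kappa>' q"
    and \<kappa>: "\<kappa> \<in> borel_measurable M" "\<kappa>' \<in> borel_measurable M"
    and "0 < lo" and bd: "AE z in M. lo \<le> \<kappa> z \<and> \<kappa> z \<le> hi" "AE z in M. lo \<le> \<kappa>' z \<and> \<kappa>' z \<le> hi"
  shows "lo * V_norm (\<lambda>z. q z - p z)
    \<le> sqrt (LINT z|M. (\<kappa> z - \<kappa>' z)\<^sup>2 * (norm (wgrad p z))\<^sup>2)"
proof -
  have V: "p \<in> V" "q \<in> V" using p q by (auto simp: weak_solution_def)
  define w where "w = (\<lambda>z. q z - p z)"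
  have wV: "w \<in> V" unfolding w_def by (intro V_diff V)
  have L2: "wgrad p \<in> L2" "wgrad q \<in> L2" "wgrad w \<in> L2"
    by (intro wgrad V_imp_H1 V wV)+
  have wdiff: "AE z in M. wgrad w z = wgrad q z - wgrad p z"
    unfolding w_def by (intro H1_diff V_imp_H1 V)
  have bd': "AE z in M. \<bar>\<kappa> z\<bar> \<le> hi" "AE z in M. \<bar>\<kappa>' z\<bar> \<le> hi"
    using bd by (eventually_elim, use \<open>0 < lo\<close> in auto)+
  have m: "(\<lambda>z. \<kappa> z *\<^sub>R wgrad p z) \<in> L2" "(\<lambda>z. \<kappa>' z *\<^sub>R wgrad p z) \<in> L2"
    "(\<lambda>z. \<kappa>' z *\<^sub>R wgrad q z) \<in> L2" "(\<lambda>z. \<kappa>' z *\<^sub>R wgrad w z) \<in> L2"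
    using L2_mult_bounded[OF L2(1) \<kappa>(1) bd'(1)] L2_mult_bounded[OF _ \<kappa>(2) bd'(2)] L2 by blast+
  define d where "d = (\<lambda>z. \<kappa> z *\<^sub>R wgrad p z - \<kappa>' z *\<^sub>R wgrad p z)"
  have d: "d \<in> L2" unfolding d_def by (intro L2.diff_closed m)
  have "lo * ip2 (wgrad w) (wgrad w) = (LINT z|M. lo * (wgrad w z \<bullet> wgrad w z))" by simp
  also have "\<dots> \<le> ip2 (\<lambda>z. \<kappa>' z *\<^sub>R wgrad w z) (wgrad w)"
  proof (rule integral_mono_AE[OF integrable_mult_right[OF L2_inner_integrable[OF L2(3) L2(3)]]
        L2_inner_integrable[OF m(4) L2(3)]])
    show "AE z in M. lo * (wgrad w z \<bullet> wgrad w z) \<le> (\<kappa>' z *\<^sub>R wgrad w z) \<bullet> wgrad w z"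
      using bd(2) by eventually_elim (simp add: mult_right_mono)
  qed
  also have "\<dots> = ip2 (\<lambda>z. \<kappa>' z *\<^sub>R wgrad q z - \<kappa>' z *\<^sub>R wgrad p z) (wgrad w)"
  proof (intro ip2_cong_AE L2.diff_closed m L2)
    show "AE z in M. \<kappa>' z *\<^sub>R wgrad w z = \<kappa>' z *\<^sub>R wgrad q z - \<kappa>' z *\<^sub>R wgrad p z"
      using wdiff by eventually_elim (simp add: scaleR_diff_right)
  qed simp
  also have "\<dots> = ip2 (\<lambda>z. \<kappa>' z *\<^sub>R wgrad q z) (wgrad w) - ip2 (\<lambda>z. \<kappa>' z *\<^sub>R wgrad p z) (wgrad w)"
    by (intro L2.diff_left m L2)
  also have "ip2 (\<lambda>z. \<kappa>' z *\<^sub>R wgrad q z) (wgrad w) = f w"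
    using q wV by (simp add: weak_solution_def)
  also have "f w = ip2 (\<lambda>z. \<kappa> z *\<^sub>R wgrad p z) (wgrad w)"
    using p wV by (simp add: weak_solution_def)
  also have "ip2 (\<lambda>z. \<kappa> z *\<^sub>R wgrad p z) (wgrad w) - ip2 (\<lambda>z. \<kappa>' z *\<^sub>R wgrad p z) (wgrad w) = ip2 d (wgrad w)"
    unfolding d_def by (rule L2.diff_left[symmetric]) (rule m L2)+
  also have "\<dots> \<le> sqrt (ip2 d d) * sqrt (ip2 (wgrad w) (wgrad w))"
    using L2.Cauchy_Schwarz_sqrt[OF d L2(3)] by simp
  finally have "(lo * sqrt (ip2 (wgrad w) (wgrad w))) * sqrt (ip2 (wgrad w) (wgrad w))
      \<le> sqrt (ip2 d d) * sqrt (ip2 (wgrad w) (wgrad w))"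
    by (simp add: mult.assoc)
  then have "lo * sqrt (ip2 (wgrad w) (wgrad w)) \<le> sqrt (ip2 d d)"
  proof (cases "ip2 (wgrad w) (wgrad w) = 0")
    case False
    then have "0 < sqrt (ip2 (wgrad w) (wgrad w))"
      by (simp add: order.strict_iff_order)
    then show ?thesis
      using mult_right_le_imp_le[of "lo * sqrt (ip2 (wgrad w) (wgrad w))"
          "sqrt (ip2 (wgrad w) (wgrad w))" "sqrt (ip2 d d)"]
        \<open>(lo * _) * _ \<le> _\<close> by blast
  qed simp
  moreover have "ip2 d d = (LINT z|M. (\<kappa> z - \<kappa>' z)\<^sup>2 * (norm (wgrad p z))\<^sup>2)"
    unfolding ip2_square d_def
    by (simp add: power_mult_distrib flip: scaleR_diff_left)
  ultimately show ?thesis unfolding V_norm_eq w_def by simp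
qed

text \<open>
  The squared coefficient difference is at most \<open>(hi - lo)\<^sup>2\<close>, so a multiple of \<open>\<bar>\<nabla>p\<bar>\<^sup>2\<close> dominates the
  integrand on the right-hand side of the stability estimate.
\<close>

theorem observation_tendsto:
  assumes f: "f \<in> V_dual" and l: "l \<in> V_dual"
    and \<kappa>: "\<kappa> \<in> borel_measurable M" "\<And>k::nat. \<kappa>s k \<in> borel_measurable M"
    and lo: "0 < lo" and bd: "AE z in M. lo \<le> \<kappa> z \<and> \<kappa> z \<le> hi"
      "\<And>k. AE z in M. lo \<le> \<kappa>s k z \<and> \<kappa>s k z \<le> hi"
    and lim: "AE z in M. (\<lambda>k. \<kappa>s k z) \<longlonglongrightarrow> \<kappa> z"
  shows "(\<lambda>k. l (G f (\<kappa>s k))) \<longlonglongrightarrow> l (G f \<kappa>)"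
proof -
  note [measurable] = \<kappa>
  define p where "p = G f \<kappa>"
  define q where "q k = G f (\<kappa>s k)" for k
  have p: "weak_solution f \<kappa> p" and q: "weak_solution f (\<kappa>s k) (q k)" for k
    unfolding p_def q_def by (rule weak_solution_exists[OF f _ lo] \<kappa> bd)+
  have V: "p \<in> V" "q k \<in> V" for k using p q by (auto simp: weak_solution_def)
  have wp: "wgrad p \<in> L2" by (intro wgrad V_imp_H1 V)
  have [measurable]: "wgrad p \<in> borel_measurable M" using wp by (rule L2_measurable)
  have "(\<lambda>k. LINT z|M. (\<kappa> z - \<kappa>s k z)\<^sup>2 * (norm (wgrad p z))\<^sup>2) \<longlonglongrightarrow> (LINT z|M. 0)"
  proof (rule integral_dominated_convergence)
    show "integrable M (\<lambda>z. (hi - lo)\<^sup>2 * (norm (wgrad p z))\<^sup>2)"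
      by (intro integrable_mult_right L2_square_integrable wp)
    show "AE z in M. (\<lambda>k. (\<kappa> z - \<kappa>s k z)\<^sup>2 * (norm (wgrad p z))\<^sup>2) \<longlonglongrightarrow> 0"
      using lim
    proof eventually_elim
      case (elim z)
      have "(\<lambda>k. (\<kappa> z - \<kappa>s k z)\<^sup>2 * (norm (wgrad p z))\<^sup>2) \<longlonglongrightarrow> (\<kappa> z - \<kappa> z)\<^sup>2 * (norm (wgrad p z))\<^sup>2"
        by (intro tendsto_intros elim)
      then show ?case by simp
    qed
    show "AE z in M. norm ((\<kappa> z - \<kappa>s k z)\<^sup>2 * (norm (wgrad p z))\<^sup>2) \<le> (hi - lo)\<^sup>2 * (norm (wgrad p z))\<^sup>2" for k
      using bd(1) bd(2)[of k]
    proof eventually_elim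
      case (elim z)
      then have "\<bar>\<kappa> z - \<kappa>s k z\<bar> \<le> hi - lo" by auto
      then have "(\<kappa> z - \<kappa>s k z)\<^sup>2 \<le> (hi - lo)\<^sup>2" by (metis abs_ge_zero power2_abs power_mono)
      then show ?case by (simp add: mult_right_mono)
    qed
  qed measurable
  from tendsto_real_sqrt[OF this]
  have rhs: "(\<lambda>k. sqrt (LINT z|M. (\<kappa> z - \<kappa>s k z)\<^sup>2 * (norm (wgrad p z))\<^sup>2)) \<longlonglongrightarrow> 0" by simp
  obtain C where C: "\<And>v. v \<in> V \<Longrightarrow> \<bar>l v\<bar> \<le> C * V_norm v" using l unfolding V_dual_def by blast
  have "norm (l (q k) - l p)
      \<le> \<bar>C\<bar> / lo * sqrt (LINT z|M. (\<kappa> z - \<kappa>s k z)\<^sup>2 * (norm (wgrad p z))\<^sup>2)" for k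
  proof -
    have "l (\<lambda>z. 1 * q k z + (-1) * p z) = 1 * l (q k) + (-1) * l p"
      using l V unfolding V_dual_def by blast
    then have "l (q k) - l p = l (\<lambda>z. q k z - p z)" by simp
    moreover have "\<bar>l (\<lambda>z. q k z - p z)\<bar> \<le> \<bar>C\<bar> * V_norm (\<lambda>z. q k z - p z)"
      using C[OF V_diff[OF V(2) V(1), of k]]
      by (rule order_trans) (simp add: V_norm_eq mult_right_mono)
    moreover have "V_norm (\<lambda>z. q k z - p z) \<le> sqrt (LINT z|M. (\<kappa> z - \<kappa>s k z)\<^sup>2 * (norm (wgrad p z))\<^sup>2) / lo"
      using weak_solution_stability[OF p q[of k] \<kappa>(1) \<kappa>(2)[of k] lo bd(1) bd(2)[of k]] lo
      by (simp add: pos_le_divide_eq mult.commute)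
    then have "\<bar>C\<bar> * V_norm (\<lambda>z. q k z - p z)
        \<le> \<bar>C\<bar> * (sqrt (LINT z|M. (\<kappa> z - \<kappa>s k z)\<^sup>2 * (norm (wgrad p z))\<^sup>2) / lo)"
      by (rule mult_left_mono) simp
    ultimately show ?thesis by simp
  qed
  moreover have "(\<lambda>k. \<bar>C\<bar> / lo * sqrt (LINT z|M. (\<kappa> z - \<kappa>s k z)\<^sup>2 * (norm (wgrad p z))\<^sup>2)) \<longlonglongrightarrow> 0"
    using tendsto_mult_left[OF rhs, of "\<bar>C\<bar> / lo"] by simp
  ultimately have "(\<lambda>k. l (q k) - l p) \<longlonglongrightarrow> 0"
    by (rule Lim_null_comparison[OF always_eventually[OF allI]])
  then show ?thesis by (simp add: LIM_zero_iff p_def q_def)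
qed


section \<open>Continuity of the observation map for a general geometry\<close>

definition lies_in_region :: "nat \<Rightarrow> (nat \<Rightarrow> (real \<times> real) set) \<Rightarrow> real \<times> real \<Rightarrow> nat \<Rightarrow> bool" where
  "lies_in_region n \<Omega> z i \<longleftrightarrow> i \<in> {1..n} \<and> (\<forall>j\<in>{1..n}. z \<in> \<Omega> j \<longleftrightarrow> j = i)"

lemma permeability_eq:
  assumes "lies_in_region n \<Omega> z i"
  shows "permeability n \<Omega> k z = k i z"
proof -
  have "permeability n \<Omega> k z = (\<Sum>j\<in>{1..n}. if j = i then k i z else 0)"
    unfolding permeability_def
    by (rule sum.cong) (use assms in \<open>auto simp: lies_in_region_def indicator_def\<close>)
  then show ?thesis using assms by (simp add: lies_in_region_def)
qed

text \<open>
  Almost every point keeps the index of its region under small changes of the geometric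
  parameter, so the permeability converges almost everywhere along convergent parameters, although it does
  not converge uniformly where an interface moves.
\<close>

theorem observation_map_continuous:
  fixes W :: "'w::metric_space set" and S :: "'v::metric_space set"
    and \<Omega> :: "'w \<Rightarrow> nat \<Rightarrow> (real \<times> real) set" and val :: "'v \<Rightarrow> nat \<Rightarrow> real \<times> real \<Rightarrow> real"
    and l :: "'j::finite \<Rightarrow> (real \<times> real \<Rightarrow> real) \<Rightarrow> real"
  assumes f: "f \<in> V_dual" and l: "\<And>j. l j \<in> V_dual"
    and \<Omega>_meas: "\<And>w i. \<Omega> w i \<in> sets borel"
    and \<Omega>_stable: "\<And>w. w \<in> W \<Longrightarrow>
      AE z in M. \<exists>i. \<forall>\<^sub>F w' in nhds w. w' \<in> W \<longrightarrow> lies_in_region n (\<Omega> w') z i"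
    and val_meas: "\<And>v i. val v i \<in> borel_measurable M"
    and val_bounds: "\<And>v. v \<in> S \<Longrightarrow>
      \<exists>lo>0. \<exists>hi. \<forall>\<^sub>F v' in nhds v. v' \<in> S \<longrightarrow> (\<forall>i. \<forall>z\<in>D. lo \<le> val v' i z \<and> val v' i z \<le> hi)"
    and val_cont: "\<And>v i z. isCont (\<lambda>v. val v i z) v"
  shows "continuous_on (W \<times> S) (L l \<circ> G f \<circ> (\<lambda>(w, v). permeability n (\<Omega> w) (val v)))"
  unfolding continuous_on_sequentially
proof (intro allI ballI impI, elim conjE)
  fix u :: "nat \<Rightarrow> 'w \<times> 'v" and a
  assume "a \<in> W \<times> S" and u: "\<forall>k. u k \<in> W \<times> S" and lim: "u \<longlonglongrightarrow> a"
  then obtain w v where a: "a = (w, v)" "w \<in> W" "v \<in> S" by blast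
  define ws where "ws k = fst (u k)" for k
  define vs where "vs k = snd (u k)" for k
  have ws: "ws k \<in> W" and vs: "vs k \<in> S" for k
    using u by (auto simp: ws_def vs_def mem_Times_iff)
  have limw: "ws \<longlonglongrightarrow> w" and limv: "vs \<longlonglongrightarrow> v"
    using tendsto_fst[OF lim] tendsto_snd[OF lim] by (simp_all add: a ws_def[abs_def] vs_def[abs_def])
  obtain lo hi where lo: "0 < lo"
    and bd: "\<forall>\<^sub>F v' in nhds v. v' \<in> S \<longrightarrow> (\<forall>i. \<forall>z\<in>D. lo \<le> val v' i z \<and> val v' i z \<le> hi)"
    using val_bounds[OF a(3)] by blast
  have bdv: "lo \<le> val v i z \<and> val v i z \<le> hi" if "z \<in> D" for i z
    using eventually_nhds_x_imp_x[OF bd] a(3) that by blast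
  have "\<forall>\<^sub>F k in sequentially. \<forall>i. \<forall>z\<in>D. lo \<le> val (vs k) i z \<and> val (vs k) i z \<le> hi"
    using filterlim_iff[THEN iffD1, OF limv, rule_format, OF bd] vs by simp
  then obtain N where bdvs: "\<And>k i z. k \<ge> N \<Longrightarrow> z \<in> D \<Longrightarrow> lo \<le> val (vs k) i z \<and> val (vs k) i z \<le> hi"
    unfolding eventually_sequentially by blast
  define \<kappa> where "\<kappa> w v = permeability n (\<Omega> w) (val v)" for w v
  have meas: "\<kappa> w v \<in> borel_measurable M" for w v
    unfolding \<kappa>_def permeability_def
    by (intro borel_measurable_sum borel_measurable_times val_meas borel_measurable_M
        borel_measurable_indicator \<Omega>_meas)
  have \<kappa>_bounds: "AE z in M. lo \<le> \<kappa> w' v' z \<and> \<kappa> w' v' z \<le> hi"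
    if "w' \<in> W" and bd: "\<And>i z. z \<in> D \<Longrightarrow> lo \<le> val v' i z \<and> val v' i z \<le> hi" for w' v'
    using \<Omega>_stable[OF that(1)] AE_space
  proof eventually_elim
    case (elim z)
    then obtain i where "\<forall>\<^sub>F w'' in nhds w'. w'' \<in> W \<longrightarrow> lies_in_region n (\<Omega> w'') z i" by blast
    from eventually_nhds_x_imp_x[OF this] that(1) have "lies_in_region n (\<Omega> w') z i" by blast
    from permeability_eq[OF this] bd[of z i] elim(2) show ?case by (simp add: \<kappa>_def)
  qed
  have \<kappa>_lim: "AE z in M. (\<lambda>k. \<kappa> (ws (k + N)) (vs (k + N)) z) \<longlonglongrightarrow> \<kappa> w v z"
    using \<Omega>_stable[OF a(2)]
  proof eventually_elim
    case (elim z)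
    then obtain i where i: "\<forall>\<^sub>F w' in nhds w. w' \<in> W \<longrightarrow> lies_in_region n (\<Omega> w') z i" by blast
    have "lies_in_region n (\<Omega> w) z i"
      using eventually_nhds_x_imp_x[OF i] a(2) by blast
    then have eq: "\<kappa> w v z = val v i z" by (simp add: \<kappa>_def permeability_eq)
    have "\<forall>\<^sub>F k in sequentially. lies_in_region n (\<Omega> (ws k)) z i"
      using filterlim_iff[THEN iffD1, OF limw, rule_format, OF i] ws by simp
    then have "\<forall>\<^sub>F k in sequentially. val (vs k) i z = \<kappa> (ws k) (vs k) z"
      by eventually_elim (simp add: \<kappa>_def permeability_eq)
    moreover have "(\<lambda>k. val (vs k) i z) \<longlonglongrightarrow> val v i z"
      using isCont_tendsto_compose[OF val_cont limv] .
    ultimately have "(\<lambda>k. \<kappa> (ws k) (vs k) z) \<longlonglongrightarrow> \<kappa> w v z"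
      unfolding eq by (rule Lim_transform_eventually[rotated])
    then show ?case by (rule LIMSEQ_ignore_initial_segment)
  qed
  have "(\<lambda>k. L l (G f (\<kappa> (ws (k + N)) (vs (k + N))))) \<longlonglongrightarrow> L l (G f (\<kappa> w v))"
    unfolding L_def
  proof (intro tendsto_vec_lambda allI)
    fix j
    show "(\<lambda>k. l j (G f (\<kappa> (ws (k + N)) (vs (k + N))))) \<longlonglongrightarrow> l j (G f (\<kappa> w v))"
    proof (rule observation_tendsto[OF f l meas meas lo _ _ \<kappa>_lim])
      show "AE z in M. lo \<le> \<kappa> w v z \<and> \<kappa> w v z \<le> hi"
        by (rule \<kappa>_bounds[OF a(2) bdv])
      show "AE z in M. lo \<le> \<kappa> (ws (k + N)) (vs (k + N)) z \<and> \<kappa> (ws (k + N)) (vs (k + N)) z \<le> hi" for k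
        by (rule \<kappa>_bounds[OF ws bdvs]) simp_all
    qed
  qed
  then have "(\<lambda>k. L l (G f (\<kappa> (ws k) (vs k)))) \<longlonglongrightarrow> L l (G f (\<kappa> w v))"
    by (rule LIMSEQ_offset)
  then show "((L l \<circ> G f \<circ> (\<lambda>(w, v). permeability n (\<Omega> w) (val v))) \<circ> u) \<longlonglongrightarrow>
      (L l \<circ> G f \<circ> (\<lambda>(w, v). permeability n (\<Omega> w) (val v))) a"
    by (simp add: a o_def case_prod_beta \<kappa>_def ws_def vs_def)
qed


section \<open>Permeability values\<close>

lemma const_values_measurable: "const_values \<nu> v i \<in> borel_measurable M"
  unfolding const_values_def by simp

text \<open>
  Positivity is an open condition on the finitely many values: near \<open>v\<close> no component drops below
  half of its value at \<open>v\<close>.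
\<close>

lemma const_values_bounds:
  fixes v :: "real ^ 'n::finite"
  assumes "v \<in> U_const"
  shows "\<exists>lo>0. \<exists>hi. \<forall>\<^sub>F v' in nhds v. v' \<in> U_const \<longrightarrow>
    (\<forall>i. \<forall>z\<in>D. lo \<le> const_values \<nu> v' i z \<and> const_values \<nu> v' i z \<le> hi)"
proof -
  define lo where "lo = Min (range (\<lambda>j. v $ j / 2))"
  have "lo > 0" using assms by (auto simp: lo_def U_const_def)
  have lo_le: "lo \<le> v $ j / 2" for j unfolding lo_def by (rule Min_le) auto
  have comp: "\<forall>\<^sub>F v' in nhds v. v $ j / 2 < v' $ j \<and> v' $ j < norm v + 1" for j
  proof -
    have lim: "((\<lambda>v'. v' $ j) \<longlongrightarrow> v $ j) (nhds v)"
      by (intro tendsto_vec_nth filterlim_ident)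
    have "v $ j / 2 < v $ j" using assms by (simp add: U_const_def)
    moreover have "v $ j < norm v + 1" using component_le_norm_cart[of v j] by linarith
    ultimately show ?thesis
      using order_tendstoD(1)[OF lim, of "v $ j / 2"] order_tendstoD(2)[OF lim, of "norm v + 1"]
      by (auto intro: eventually_conj)
  qed
  have "\<forall>\<^sub>F v' in nhds v. \<forall>j. v $ j / 2 < v' $ j \<and> v' $ j < norm v + 1"
    using comp by (rule eventually_all_finite)
  then have "\<forall>\<^sub>F v' in nhds v. v' \<in> U_const \<longrightarrow>
      (\<forall>i. \<forall>z\<in>D. lo \<le> const_values \<nu> v' i z \<and> const_values \<nu> v' i z \<le> norm v + 1)"
    unfolding const_values_def
    by eventually_elim (meson lo_le less_imp_le le_less_trans)
  then show ?thesis using \<open>lo > 0\<close> by blast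
qed

lemma const_values_isCont: "isCont (\<lambda>v. const_values \<nu> v i z) v"
  unfolding const_values_def by (intro continuous_intros)

text \<open>The topology of the closed square as a type is the one induced by the plane.\<close>

lemma continuous_on_Square_Point: "continuous_on D Square_Point"
  unfolding continuous_on_open_vimage[OF open_D]
proof (intro allI impI)
  fix B :: "closed_square set" assume "open B"
  then obtain T where T: "open T" "B = square_point -` T"
    unfolding open_closed_square_def by blast
  have "Square_Point -` B \<inter> D = T \<inter> D"
    using closure_subset[of D] by (auto simp: T(2) Square_Point_inverse subset_iff)
  then show "open (Square_Point -` B \<inter> D)" using T(1) open_D by auto
qed

lemma cont_values_measurable: "cont_values \<nu> v i \<in> borel_measurable M"
proof -
  have "continuous_on D (\<lambda>z. apply_bcontfun v (Square_Point z))"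
    using continuous_on_apply_bcontfun[of UNIV v] continuous_on_Square_Point
    by (rule continuous_on_compose2) simp
  then have "continuous_on D (cont_values \<nu> v i)"
    unfolding cont_values_def by (intro continuous_intros)
  then show ?thesis by (rule continuous_imp_measurable_on_sets_lebesgue) simp
qed

lemma cont_values_bounds:
  fixes v :: "closed_square \<Rightarrow>\<^sub>C (real ^ 'n::finite)"
  shows "\<exists>lo>0. \<exists>hi. \<forall>\<^sub>F v' in nhds v. v' \<in> UNIV \<longrightarrow>
    (\<forall>i. \<forall>z\<in>D. lo \<le> cont_values \<nu> v' i z \<and> cont_values \<nu> v' i z \<le> hi)"
proof -
  have "\<forall>\<^sub>F v' in nhds v. norm v' < norm v + 1"
    by (rule order_tendstoD(2)[OF tendsto_norm[OF filterlim_ident]]) simp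
  then have "\<forall>\<^sub>F v' in nhds v. v' \<in> UNIV \<longrightarrow> (\<forall>i. \<forall>z\<in>D.
      exp (- (norm v + 1)) \<le> cont_values \<nu> v' i z \<and> cont_values \<nu> v' i z \<le> exp (norm v + 1))"
  proof eventually_elim
    case (elim v')
    have "\<bar>apply_bcontfun v' x $ j\<bar> \<le> norm v + 1" for x j
      using component_le_norm_cart[of "apply_bcontfun v' x" j] norm_bounded[of v' x] elim by linarith
    then show ?case unfolding cont_values_def by (auto simp: abs_le_iff minus_le_iff)
  qed
  moreover have "exp (- (norm v + 1)) > 0" by simp
  ultimately show ?thesis by blast
qed

lemma cont_values_isCont: "isCont (\<lambda>v. cont_values \<nu> v i z) v"
proof -
  have "((\<lambda>v'. apply_bcontfun v' x) \<longlongrightarrow> apply_bcontfun v x) (at v)" for x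
    by (rule metric_tendsto_imp_tendsto[OF tendsto_ident_at]) (simp add: dist_bounded)
  then show ?thesis
    unfolding cont_values_def isCont_def by (intro tendsto_intros)
qed


section \<open>Interfaces are null sets\<close>

lemma isCont_imp_tendsto_nhds: "isCont h a \<Longrightarrow> (h \<longlongrightarrow> h a) (nhds a)"
  by (simp add: isCont_def tendsto_at_iff_tendsto_nhds)

lemma AE_M_I: "AE z in lborel. P z \<Longrightarrow> AE z in M. P z"
  by (rule AE_restrict_space_iff[THEN iffD2]) (auto dest: AE_completion)

lemma borel_measurable_fst_snd:
  "(fst :: real \<times> real \<Rightarrow> real) \<in> borel_measurable borel"
  "(snd :: real \<times> real \<Rightarrow> real) \<in> borel_measurable borel"
  by (auto intro!: borel_measurable_continuous_onI continuous_intros)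

text \<open>Every vertical section of a graph is a single point, so Fubini's theorem applies.\<close>

lemma AE_off_graph:
  assumes h: "h \<in> borel_measurable borel"
  shows "AE z in M. snd z \<noteq> h (fst z)"
proof (rule AE_M_I)
  have "AE z in lborel \<Otimes>\<^sub>M lborel. snd z \<noteq> h (fst z)"
  proof (rule lborel_pair.AE_pair_measure)
    have "(\<lambda>z. h (fst z)) \<in> borel_measurable (borel :: (real \<times> real) measure)"
      using measurable_compose[OF borel_measurable_fst_snd(1) h] .
    then show "{z \<in> space (lborel \<Otimes>\<^sub>M lborel). snd z \<noteq> h (fst z)} \<in> sets (lborel \<Otimes>\<^sub>M lborel)"
      unfolding lborel_prod
      using borel_measurable_neq[OF borel_measurable_fst_snd(2)] by simp
    show "AE x in lborel. AE y in lborel. snd (x, y) \<noteq> h (fst (x, y))"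
      by (simp add: AE_lborel_singleton)
  qed
  then show "AE z in lborel. snd z \<noteq> h (fst z)" unfolding lborel_prod .
qed

lemma AE_off_vertical_line: "AE z in M. fst z \<noteq> c"
proof (rule AE_M_I)
  have "AE z in (lborel \<Otimes>\<^sub>M lborel :: (real \<times> real) measure). fst z \<noteq> c"
  proof (rule lborel_pair.AE_pair_measure)
    show "{z \<in> space (lborel \<Otimes>\<^sub>M lborel). fst z \<noteq> c}
        \<in> sets (lborel \<Otimes>\<^sub>M lborel :: (real \<times> real) measure)"
      unfolding lborel_prod
      using borel_measurable_neq[OF borel_measurable_fst_snd(1) borel_measurable_const] by simp
    show "AE x in lborel. AE y::real in lborel. fst (x, y) \<noteq> c"
      using AE_lborel_singleton[of c] by eventually_elim simp
  qed
  then show "AE z :: real \<times> real in lborel. fst z \<noteq> c" unfolding lborel_prod .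
qed


section \<open>The layer model\<close>

text \<open>The real-valued depth of an interface, for \<open>0 < i < n\<close>, without the infinite end values of \<open>layer_S\<close>.\<close>

definition layer_depth :: "(nat \<Rightarrow> 'm) \<Rightarrow> (real ^ 'm::finite) \<times> (real ^ 'm) \<times> real \<Rightarrow> nat \<Rightarrow> real \<Rightarrow> real" where
  "layer_depth \<mu> w i x = layer_h \<mu> (fst w) (fst (snd w)) i x + (if x < 1/2 then snd (snd w) else 0)"

lemma layer_S_eq: "layer_S n \<mu> w i x =
    (if i = 0 then -\<infinity> else if i = n then \<infinity> else ereal (layer_depth \<mu> w i x))"
  by (cases w) (simp add: layer_S_def layer_depth_def)

lemma layer_depth_measurable: "layer_depth \<mu> w i \<in> borel_measurable borel"
  unfolding layer_depth_def layer_h_def by measurable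

lemma layer_depth_isCont: "isCont (\<lambda>w. layer_depth \<mu> w i x) w"
  unfolding layer_depth_def layer_h_def by (cases "x < 1/2") (simp_all add: continuous_intros)

lemma layer_region_measurable: "layer_region n \<mu> w i \<in> sets borel"
proof -
  have "(\<lambda>z. layer_depth \<mu> w i (fst z)) \<in> borel_measurable (borel :: (real \<times> real) measure)" for i
    by (rule measurable_compose[OF borel_measurable_fst_snd(1) layer_depth_measurable])
  then have S: "(\<lambda>z. layer_S n \<mu> w i (fst z)) \<in> borel_measurable (borel :: (real \<times> real) measure)" for i
    unfolding layer_S_eq by (cases "i = 0"; cases "i = n") simp_all
  have Y: "(\<lambda>z. ereal (1 - snd z)) \<in> borel_measurable (borel :: (real \<times> real) measure)"
    by (intro borel_measurable_ereal borel_measurable_diff borel_measurable_const borel_measurable_fst_snd)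
  have "layer_region n \<mu> w i = D \<inter> {z \<in> space borel. fst z \<noteq> 1/2}
      \<inter> {z \<in> space borel. layer_S n \<mu> w (i - 1) (fst z) < ereal (1 - snd z)}
      \<inter> {z \<in> space borel. ereal (1 - snd z) < layer_S n \<mu> w i (fst z)}"
    by (auto simp: layer_region_def)
  then show ?thesis
    using borel_measurable_neq[OF borel_measurable_fst_snd(1) borel_measurable_const]
    by (simp only: sets.Int sets_D borel_measurable_less[OF S Y] borel_measurable_less[OF Y S])
qed

lemma layer_S_mono:
  assumes w: "w \<in> U_layer cstar" and x: "0 < x" "x < 1" and ij: "i \<le> j" "j \<le> n"
  shows "layer_S n \<mu> w i x \<le> layer_S n \<mu> w j x"
proof -
  obtain a b c where abc: "w = (a, b, c)" "\<And>k. 0 \<le> a $ k" "\<And>k. 0 \<le> b $ k"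
    using w unfolding U_layer_def A_def by auto
  have "layer_h \<mu> a b i x \<le> layer_h \<mu> a b j x"
    unfolding layer_h_def using ij(1) x abc
    by (intro sum_mono2) auto
  then show ?thesis using ij by (auto simp: layer_S_eq layer_depth_def abc(1))
qed

text \<open>Since the depths increase with the index, the strips between consecutive interfaces are disjoint.\<close>

lemma layer_region_unique:
  assumes w: "w \<in> U_layer cstar" and z: "(x, y) \<in> D" "x \<noteq> 1/2" and i: "i \<in> {1..n}"
    and S: "layer_S n \<mu> w (i - 1) x < ereal (1 - y)" "ereal (1 - y) < layer_S n \<mu> w i x"
  shows "lies_in_region n (layer_region n \<mu> w) (x, y) i"
proof -
  have x: "0 < x" "x < 1" using z by (auto simp: D_def)
  have "j = i" if j: "j \<in> {1..n}" "(x, y) \<in> layer_region n \<mu> w j" for j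
  proof (rule ccontr)
    assume "j \<noteq> i"
    have Sj: "layer_S n \<mu> w (j - 1) x < ereal (1 - y)" "ereal (1 - y) < layer_S n \<mu> w j x"
      using j(2) by (auto simp: layer_region_def)
    from \<open>j \<noteq> i\<close> consider "j \<le> i - 1" | "i \<le> j - 1" by linarith
    then show False
    proof cases
      case 1
      then have "layer_S n \<mu> w j x \<le> layer_S n \<mu> w (i - 1) x"
        using i by (intro layer_S_mono[OF w x]) auto
      then show False using S(1) Sj(2) by (meson leD less_le_trans less_trans)
    next
      case 2
      then have "layer_S n \<mu> w i x \<le> layer_S n \<mu> w (j - 1) x"
        using j by (intro layer_S_mono[OF w x]) auto
      then show False using S(2) Sj(1) by (meson leD less_le_trans less_trans)
    qed
  qed
  moreover have "(x, y) \<in> layer_region n \<mu> w i" using z S by (simp add: layer_region_def)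
  ultimately show ?thesis using i unfolding lies_in_region_def by blast
qed

text \<open>
  Off the interfaces, the strict inequalities that place a point in its layer persist for nearby
  parameters, because the depths at a fixed \<open>x\<close> depend continuously on the parameter.
\<close>

lemma layer_region_stable:
  assumes w: "w \<in> U_layer cstar" and n: "n \<ge> 2"
  shows "AE z in M. \<exists>i. \<forall>\<^sub>F w' in nhds w. w' \<in> U_layer cstar \<longrightarrow>
    lies_in_region n (layer_region n \<mu> w') z i"
proof -
  have "AE z in M. \<forall>i\<in>{1..n}. snd z \<noteq> 1 - layer_depth \<mu> w i (fst z)"
    by (intro AE_finite_allI AE_off_graph borel_measurable_diff borel_measurable_const layer_depth_measurable) simp
  with AE_off_vertical_line[of "1/2"] AE_space show ?thesis
  proof eventually_elim
    case (elim z)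
    obtain x y where z: "z = (x, y)" by fastforce
    have zD: "(x, y) \<in> D" "x \<noteq> 1/2" using elim z by auto
    \<comment> \<open>The layer of the point ends at the first interface that lies below the point.\<close>
    define i where "i = (LEAST i. ereal (1 - y) < layer_S n \<mu> w i x)"
    have ex: "ereal (1 - y) < layer_S n \<mu> w n x" using n by (simp add: layer_S_eq)
    have upper: "ereal (1 - y) < layer_S n \<mu> w i x" unfolding i_def using ex by (rule LeastI)
    have "i \<noteq> 0" using upper by (cases "i = 0") (simp_all add: layer_S_eq)
    moreover have "i \<le> n" unfolding i_def using ex by (rule Least_le)
    ultimately have i: "i \<in> {1..n}" by simp
    have "i - 1 < i" using \<open>i \<noteq> 0\<close> by simp
    then have "\<not> ereal (1 - y) < layer_S n \<mu> w (i - 1) x"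
      unfolding i_def by (rule not_less_Least)
    moreover have "ereal (1 - y) \<noteq> layer_S n \<mu> w (i - 1) x"
      using elim(3) i z by (auto simp: layer_S_eq dest!: bspec[of _ _ "i - 1"])
    ultimately have lower: "layer_S n \<mu> w (i - 1) x < ereal (1 - y)" by simp
    have "((\<lambda>w'. layer_depth \<mu> w' j x) \<longlongrightarrow> layer_depth \<mu> w j x) (nhds w)" for j
      by (rule isCont_imp_tendsto_nhds) (rule layer_depth_isCont)
    then have lim: "((\<lambda>w'. layer_S n \<mu> w' j x) \<longlongrightarrow> layer_S n \<mu> w j x) (nhds w)" for j
      unfolding layer_S_eq by simp
    have "\<forall>\<^sub>F w' in nhds w. w' \<in> U_layer cstar \<longrightarrow> lies_in_region n (layer_region n \<mu> w') z i"
      using order_tendstoD(2)[OF lim lower] order_tendstoD(1)[OF lim upper]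
      by eventually_elim (use layer_region_unique zD i z in blast)
    then show ?case by blast
  qed
qed


section \<open>The channelized model\<close>

lemma channel_g_continuous: "continuous_on UNIV (channel_g d)"
  unfolding channel_g_def by (intro continuous_intros)

lemma channel_interior_open: "open (channel_interior d)"
proof -
  have "channel_interior d = D \<inter> {z. channel_g d (fst z) < snd z} \<inter> {z. snd z < channel_g d (fst z) + d $ 5}"
    by (auto simp: channel_interior_def)
  moreover have "continuous_on UNIV (\<lambda>z :: real \<times> real. channel_g d (fst z))"
    by (rule continuous_on_compose2[OF channel_g_continuous]) (auto intro!: continuous_intros)
  ultimately show ?thesis
    using open_D by (auto intro!: open_Int open_Collect_less continuous_intros)
qed

text \<open>
  The exterior region is the complement of a closure; this bound shows that every point strictly
  above or below the channel belongs to it.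
\<close>

lemma closure_channel_interior:
  "closure (channel_interior d) \<subseteq> {z. channel_g d (fst z) \<le> snd z \<and> snd z \<le> channel_g d (fst z) + d $ 5}"
proof (rule closure_minimal)
  have "continuous_on UNIV (\<lambda>z :: real \<times> real. channel_g d (fst z))"
    by (rule continuous_on_compose2[OF channel_g_continuous]) (auto intro!: continuous_intros)
  then show "closed {z :: real \<times> real. channel_g d (fst z) \<le> snd z \<and> snd z \<le> channel_g d (fst z) + d $ 5}"
    by (intro closed_Collect_conj closed_Collect_le continuous_intros)
qed (auto simp: channel_interior_def)

lemma channel_region_measurable: "channel_region d i \<in> sets borel"
  using channel_interior_open[of d] by (auto simp: channel_region_def)

lemma channel_g_isCont:
  assumes "cos (d $ 3) \<noteq> 0"
  shows "isCont (\<lambda>d. channel_g d x) d"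
proof -
  have "isCont (\<lambda>d. tan (d $ 3)) d"
    by (rule isCont_o2[where f = "\<lambda>d. d $ 3"]) (intro continuous_intros isCont_tan assms)+
  then show ?thesis unfolding channel_g_def by (intro continuous_intros)
qed

text \<open>
  As for the layers, strict inequalities persist for nearby parameters. The range of \<open>d $ 3\<close> keeps it away from the poles
  of the tangent. If the channel has width zero, its two boundary graphs coincide and every point
  off them is an exterior point; nearby channels of positive width still miss it.
\<close>

lemma channel_region_stable:
  assumes d: "d \<in> U_channel dm dp" and d3: "{dm $ 3..dp $ 3} \<subseteq> {-pi/2<..<pi/2}"
  shows "AE z in M. \<exists>i. \<forall>\<^sub>F d' in nhds d. d' \<in> U_channel dm dp \<longrightarrow>
    lies_in_region 2 (channel_region d') z i"
proof -
  have g: "channel_g d \<in> borel_measurable borel"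
    using channel_g_continuous by (rule borel_measurable_continuous_onI)
  have "d $ 3 \<in> {dm $ 3..dp $ 3}" using d by (simp add: U_channel_def)
  then have "d $ 3 \<in> {-pi/2<..<pi/2}" using d3 by blast
  then have "cos (d $ 3) \<noteq> 0" using cos_gt_zero_pi[of "d $ 3"] by auto
  then have lim1: "((\<lambda>d'. channel_g d' x) \<longlongrightarrow> channel_g d x) (nhds d)" for x
    by (intro isCont_imp_tendsto_nhds channel_g_isCont)
  have lim2: "((\<lambda>d'. channel_g d' x + d' $ 5) \<longlongrightarrow> channel_g d x + d $ 5) (nhds d)" for x
    by (intro tendsto_add lim1 tendsto_vec_nth filterlim_ident)
  have in2: "j \<in> {1..2} \<longleftrightarrow> j = 1 \<or> j = 2" for j :: nat by auto
  have inside: "lies_in_region 2 (channel_region d') (x, y) 1"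
    if "(x, y) \<in> D" "channel_g d' x < y" "y < channel_g d' x + d' $ 5" for d' x y
  proof -
    have "(x, y) \<in> channel_interior d'" using that by (simp add: channel_interior_def)
    then show ?thesis
      using closure_subset[of "channel_interior d'"]
      unfolding lies_in_region_def in2 channel_region_def by auto
  qed
  have outside: "lies_in_region 2 (channel_region d') (x, y) 2"
    if "(x, y) \<in> D" "y < channel_g d' x \<or> channel_g d' x + d' $ 5 < y" for d' x y
  proof -
    have "(x, y) \<notin> closure (channel_interior d')"
      using closure_channel_interior[of d'] that(2) by auto
    then show ?thesis
      using closure_subset[of "channel_interior d'"] that(1)
      unfolding lies_in_region_def in2 channel_region_def by auto
  qed
  have "AE z in M. snd z \<noteq> channel_g d (fst z)"
    by (rule AE_off_graph[OF g])
  moreover have "AE z in M. snd z \<noteq> channel_g d (fst z) + d $ 5"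
    by (rule AE_off_graph[of "\<lambda>x. channel_g d x + d $ 5"]) (use g in measurable)
  ultimately show ?thesis using AE_space
  proof eventually_elim
    case (elim z)
    obtain x y where z: "z = (x, y)" by fastforce
    have zD: "(x, y) \<in> D" using elim z by auto
    consider "channel_g d x < y \<and> y < channel_g d x + d $ 5" | "y < channel_g d x" | "channel_g d x + d $ 5 < y"
      using elim z by fastforce
    then show ?case
    proof cases
      case 1
      have "\<forall>\<^sub>F d' in nhds d. d' \<in> U_channel dm dp \<longrightarrow> lies_in_region 2 (channel_region d') z 1"
        using order_tendstoD(2)[OF lim1 conjunct1[OF 1]] order_tendstoD(1)[OF lim2 conjunct2[OF 1]]
        unfolding z
        by eventually_elim (blast intro: inside zD)
      then show ?thesis by blast
    next
      case 2
      have "\<forall>\<^sub>F d' in nhds d. d' \<in> U_channel dm dp \<longrightarrow> lies_in_region 2 (channel_region d') z 2"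
        using order_tendstoD(1)[OF lim1 2] unfolding z
        by eventually_elim (blast intro: outside zD)
      then show ?thesis by blast
    next
      case 3
      have "\<forall>\<^sub>F d' in nhds d. d' \<in> U_channel dm dp \<longrightarrow> lies_in_region 2 (channel_region d') z 2"
        using order_tendstoD(2)[OF lim2 3] unfolding z
        by eventually_elim (blast intro: outside zD)
      then show ?thesis by blast
    qed
  qed
qed


section \<open>Continuity for the four parameterizations\<close>

theorem theorem2p2:
  fixes f :: "(real \<times> real \<Rightarrow> real) \<Rightarrow> real"
    and l :: "'j::finite \<Rightarrow> (real \<times> real \<Rightarrow> real) \<Rightarrow> real"
    and n :: nat
    and \<mu> :: "nat \<Rightarrow> 'm::finite"
    and \<nu> :: "nat \<Rightarrow> 'n::finite"
    and cstar :: real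
    and dm dp :: "real ^ 5"
  assumes "f \<in> V_dual"
    and "\<And>j. l j \<in> V_dual"
    and "n \<ge> 2"
    and "bij_betw \<mu> {1..n-1} UNIV"
    and "bij_betw \<nu> {1..n} UNIV"
    and "cstar > 0"
    and "\<And>i. dm $ i \<le> dp $ i"
    and "{dm $ 3..dp $ 3} \<subseteq> {-pi/2<..<pi/2}"
    and "dm $ 5 \<ge> 0"
  shows "continuous_on (U_layer cstar \<times> U_const) (L l \<circ> G f \<circ> F_layer_const n \<mu> \<nu>)
    \<and> continuous_on (U_layer cstar \<times> UNIV) (L l \<circ> G f \<circ> F_layer_cont n \<mu> \<nu>)
    \<and> continuous_on (U_channel dm dp \<times> U_const) (L l \<circ> G f \<circ> F_channel_const)
    \<and> continuous_on (U_channel dm dp \<times> UNIV) (L l \<circ> G f \<circ> F_channel_cont)"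
proof -
  note layer = layer_region_measurable layer_region_stable[OF _ \<open>n \<ge> 2\<close>]
  note channel = channel_region_measurable channel_region_stable[OF _ assms(8)]
  note const = const_values_measurable const_values_bounds const_values_isCont
  note cont = cont_values_measurable cont_values_bounds cont_values_isCont
  note cts = observation_map_continuous[OF assms(1,2)]
  show ?thesis
    unfolding F_layer_const_def F_layer_cont_def F_channel_const_def F_channel_cont_def
    by (intro conjI cts[OF layer const] cts[OF layer cont] cts[OF channel const] cts[OF channel cont])
qed

end
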